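(* Let $s$ be a positive integer. (1) Suppose $s\le 27$ and $s\neq 24$. Then for all but finitely many nonzero integers $r$, the number $s/r$ is a $2$-step relation number. Moreover, for every nonzero integer $r$ satisfying $s/r\in(-4,4)$, the number $s/r$ is a relation number. (2) If $s=24$, then there is a subset of $\mathbb{N}$ of natural density $1$ such that $s/r$ is a $2$-step relation number for all $r$ in this subset.
   Context: For $q\in\mathbb{C}$ let $a=\begin{pmatrix}1&0\\1&1\end{pmatrix}$, $b_q=\begin{pmatrix}1&q\\0&1\end{pmatrix}$, and let $G_q=\langle a,b_q\rangle\le \mathrm{SL}_2(\mathbb{C})$. A number $q\in\mathbb{C}$ is a relation number if $G_q$ is not a rank-two free group. For an integer $\ell\ge 0$, $q\in\mathbb{C}$ is an $\ell$-step relation number if there exist an integer $k$ with $0\le k\le \ell$ and nonzero integers $m_1,\dots,m_{2k+1}$ such that the matrix $b_q^{m_1}a^{m_2}b_q^{m_3}a^{m_4}\cdots a^{m_{2k}}b_q^{m_{2k+1}}$ is lower-triangular. $\mathbb{N}$ is the set of positive integers. A set $X\subseteq\mathbb{Z}$ has natural density $\delta$ if $\lim_{N\to\infty}\#(X\cap[1,N])/N=\delta$. *)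

theory Defs
  imports "HOL-Analysis.Analysis" "HOL-Algebra.Generated_Groups"
begin

subsection \<open>Free groups\<close>

text \<open>The free group on a set \<open>X\<close> is realised on reduced words. The letter \<open>(x, True)\<close> stands for
  the generator \<open>x\<close>, and \<open>(x, False)\<close> for its formal inverse.\<close>

definition inv_letter :: "'x \<times> bool \<Rightarrow> 'x \<times> bool" where
  "inv_letter l = (fst l, \<not> snd l)"

fun freely_reduced :: "('x \<times> bool) list \<Rightarrow> bool" where
  "freely_reduced [] \<longleftrightarrow> True"
| "freely_reduced [l] \<longleftrightarrow> True"
| "freely_reduced (l # l' # w) \<longleftrightarrow> l' \<noteq> inv_letter l \<and> freely_reduced (l' # w)"

fun cons_reduce :: "'x \<times> bool \<Rightarrow> ('x \<times> bool) list \<Rightarrow> ('x \<times> bool) list" where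
  "cons_reduce l [] = [l]"
| "cons_reduce l (l' # w) = (if l' = inv_letter l then w else l # l' # w)"

definition free_group :: "'x set \<Rightarrow> ('x \<times> bool) list monoid" where
  "free_group X =
     \<lparr>carrier = {w. freely_reduced w \<and> fst ` set w \<subseteq> X},
      mult = (\<lambda>u v. foldr cons_reduce u v),
      one = []\<rparr>"

definition rank_two_free :: "('g, 'm) monoid_scheme \<Rightarrow> bool" where
  "rank_two_free G \<longleftrightarrow> G \<cong> free_group {1, 2 :: nat}"

lemma inv_letter_inv_letter [simp]: "inv_letter (inv_letter l) = l"
  by (simp add: inv_letter_def)

lemma fst_inv_letter [simp]: "fst (inv_letter l) = fst l"
  by (simp add: inv_letter_def)

lemma inv_letter_neq [simp]: "inv_letter l \<noteq> l" "l \<noteq> inv_letter l"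
  by (auto simp: inv_letter_def prod_eq_iff)

lemma reduced_ConsD: "freely_reduced (l # w) \<Longrightarrow> freely_reduced w"
  by (cases w) auto

lemma reduced_cons_reduce: "freely_reduced w \<Longrightarrow> freely_reduced (cons_reduce l w)"
  by (cases w) (auto dest: reduced_ConsD)

lemma letters_cons_reduce: "fst ` set (cons_reduce l w) \<subseteq> insert (fst l) (fst ` set w)"
  by (cases w) auto

lemma cons_reduce_inv: "freely_reduced w \<Longrightarrow> cons_reduce (inv_letter l) (cons_reduce l w) = w"
  by (cases w rule: freely_reduced.cases) auto

lemma cons_reduce_inv': "freely_reduced w \<Longrightarrow> cons_reduce l (cons_reduce (inv_letter l) w) = w"
  using cons_reduce_inv[of w "inv_letter l"] by simp

lemma reduced_foldr: "freely_reduced v \<Longrightarrow> freely_reduced (foldr cons_reduce u v)"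
  by (induction u) (auto intro: reduced_cons_reduce)

lemma letters_foldr: "fst ` set (foldr cons_reduce u v) \<subseteq> fst ` set u \<union> fst ` set v"
proof (induction u)
  case (Cons l u)
  then show ?case using letters_cons_reduce[of l "foldr cons_reduce u v"] by simp blast
qed simp

lemma foldr_cons_reduce_reduced: "freely_reduced u \<Longrightarrow> foldr cons_reduce u [] = u"
proof (induction u)
  case (Cons l u)
  then show ?case by (cases u) auto
qed simp

lemma foldr_cons_reduce_assoc:
  assumes "freely_reduced w" "freely_reduced v"
  shows "foldr cons_reduce (foldr cons_reduce u v) w = foldr cons_reduce u (foldr cons_reduce v w)"
proof (induction u)
  case (Cons l u)
  let ?x = "foldr cons_reduce u v"
  have "foldr cons_reduce (cons_reduce l ?x) w = cons_reduce l (foldr cons_reduce ?x w)"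
  proof (cases ?x)
    case (Cons l' y)
    then show ?thesis
      using cons_reduce_inv'[OF reduced_foldr[OF assms(1)], of l y] by auto
  qed simp
  then show ?case using Cons by simp
qed simp

lemma foldr_cons_reduce_left_inverse:
  assumes "freely_reduced v"
  shows "foldr cons_reduce (rev (map inv_letter u)) (foldr cons_reduce u v) = v"
  by (induction u) (simp_all add: cons_reduce_inv reduced_foldr assms)

lemma group_free_group: "group (free_group X)"
proof (rule groupI)
  fix u assume u: "u \<in> carrier (free_group X)"
  define w where "w = foldr cons_reduce (rev (map inv_letter u)) []"
  have "w \<in> carrier (free_group X)"
    using letters_foldr[of "rev (map inv_letter u)" "[]"] u reduced_foldr[of "[]"]
    by (auto simp: w_def free_group_def image_image)
  moreover have "w \<otimes>\<^bsub>free_group X\<^esub> u = \<one>\<^bsub>free_group X\<^esub>"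
    using u foldr_cons_reduce_assoc[of u "[]" "rev (map inv_letter u)"]
      foldr_cons_reduce_left_inverse[of "[]" u]
    by (simp add: w_def free_group_def foldr_cons_reduce_reduced)
  ultimately show "\<exists>w\<in>carrier (free_group X). w \<otimes>\<^bsub>free_group X\<^esub> u = \<one>\<^bsub>free_group X\<^esub>" by blast
next
  fix u v assume "u \<in> carrier (free_group X)" "v \<in> carrier (free_group X)"
  then show "u \<otimes>\<^bsub>free_group X\<^esub> v \<in> carrier (free_group X)"
    using letters_foldr[of u v] by (simp add: free_group_def reduced_foldr) blast
qed (auto simp: free_group_def foldr_cons_reduce_assoc)


subsection \<open>The groups \<open>G\<^sub>q\<close> and relation numbers\<close>

definition SL2 :: "(complex^2^2) monoid" where
  "SL2 = \<lparr>carrier = {A. det A = 1}, mult = (**), one = mat 1\<rparr>"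

lemma group_SL2: "group SL2"
proof (rule groupI)
  fix A assume "A \<in> carrier SL2"
  then have A: "det A = 1" by (simp add: SL2_def)
  then obtain B where B: "B ** A = mat 1"
    by (metis invertible_det_nz invertible_def zero_neq_one)
  then have "det B = 1"
    by (metis A det_I det_mul mult.right_neutral)
  with B show "\<exists>B\<in>carrier SL2. B \<otimes>\<^bsub>SL2\<^esub> A = \<one>\<^bsub>SL2\<^esub>" by (auto simp: SL2_def)
qed (auto simp: SL2_def det_mul matrix_mul_assoc)

definition mat_a :: "complex^2^2" where
  "mat_a = vector [vector [1, 0], vector [1, 1]]"

definition mat_b :: "complex \<Rightarrow> complex^2^2" where
  "mat_b q = vector [vector [1, q], vector [0, 1]]"

lemma mat_a_in_SL2: "mat_a \<in> carrier SL2"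
  by (simp add: SL2_def mat_a_def det_2)

lemma mat_b_in_SL2: "mat_b q \<in> carrier SL2"
  by (simp add: SL2_def mat_b_def det_2)

definition Gq :: "complex \<Rightarrow> (complex^2^2) monoid" where
  "Gq q = SL2\<lparr>carrier := generate SL2 {mat_a, mat_b q}\<rparr>"

definition relation_number :: "complex \<Rightarrow> bool" where
  "relation_number q \<longleftrightarrow> \<not> rank_two_free (Gq q)"

text \<open>\<open>alt_word q m k\<close> is the product
  \<open>b\<^sub>q^(m 1) a^(m 2) b\<^sub>q^(m 3) \<cdots> a^(m (2k)) b\<^sub>q^(m (2k+1))\<close>; the value \<open>m 0\<close> is not used.\<close>

fun alt_word :: "complex \<Rightarrow> (nat \<Rightarrow> int) \<Rightarrow> nat \<Rightarrow> complex^2^2" where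
  "alt_word q m 0 = mat_b q [^]\<^bsub>SL2\<^esub> m 1"
| "alt_word q m (Suc k) =
     alt_word q m k \<otimes>\<^bsub>SL2\<^esub> mat_a [^]\<^bsub>SL2\<^esub> m (2 * k + 2) \<otimes>\<^bsub>SL2\<^esub> mat_b q [^]\<^bsub>SL2\<^esub> m (2 * k + 3)"

definition lower_triangular :: "complex^2^2 \<Rightarrow> bool" where
  "lower_triangular A \<longleftrightarrow> A $ 1 $ 2 = 0"

definition step_relation_number :: "nat \<Rightarrow> complex \<Rightarrow> bool" where
  "step_relation_number l q \<longleftrightarrow>
     (\<exists>k \<le> l. \<exists>m :: nat \<Rightarrow> int.
        (\<forall>i \<in> {1..2 * k + 1}. m i \<noteq> 0) \<and> lower_triangular (alt_word q m k))"


subsection \<open>Natural density\<close>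

definition has_natural_density :: "int set \<Rightarrow> real \<Rightarrow> bool" where
  "has_natural_density X \<delta> \<longleftrightarrow>
     (\<lambda>N::nat. real (card (X \<inter> {1..int N})) / real N) \<longlonglongrightarrow> \<delta>"

end

theory Submission
  imports Defs "HOL-Algebra.Bij" "HOL-Number_Theory.Totient"
begin

text \<open>
  Let \<open>q = s / r\<close>. If \<open>s x = u r - 1\<close> and \<open>\<mu>\<close>, \<open>\<nu>\<close> are divisors of \<open>x\<close> with \<open>u\<close> dividing \<open>\<mu> + \<nu> \<noteq> 0\<close>, then
  the exponents \<open>r \<mu>, x / \<mu>, - (\<mu> + \<nu>) / u, x / \<nu>, r \<nu>\<close> make \<open>q\<close> a 2-step relation number. Taking
  \<open>\<mu> = d1\<close> and \<open>\<nu> = x / d2\<close> for small \<open>d1\<close>, \<open>d2\<close>, this handles a whole residue class of \<open>r\<close> except for at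
  most a few values; it also handles all multiples \<open>p r\<close>, because an \<open>l\<close>-step relation for \<open>q\<close> gives one
  for \<open>q / p\<close>. For \<open>s \<le> 27\<close>, \<open>s \<noteq> 24\<close> finitely many such classes cover all \<open>r\<close> coprime to \<open>s\<close>, and the
  exceptional \<open>r\<close> with \<open>s / r < 4\<close> have explicit longer words.

  For \<open>s = 24\<close> every \<open>r\<close> coprime to 24 satisfies \<open>r\<^sup>2 \<equiv> 1\<close>, so \<open>u = r mod 24\<close> is available, and
  by the pigeonhole principle it suffices that \<open>x\<close> has 24 distinct divisors. That this fails
  only on a set of density zero is a sieve bound, based on the divergence of the harmonic series.

  A lower-triangular word \<open>w\<close> gives the relation \<open>[w a w\<^sup>-\<^sup>1, a] = 1\<close>. It rules out that the group is
  free of rank two on any generators, because \<open>a\<close> and \<open>b\<close> would then, free groups being Hopfian,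
  admit arbitrary images in finite groups, and the relation fails for the images of \<open>a\<close> and \<open>b\<^sub>4\<close>
  modulo a suitable integer.
\<close>

subsection \<open>Homomorphisms from free groups\<close>

text \<open>An additive map from the integers into a group is determined by its value at 1. Powers
  of \<open>mat_a\<close>, of \<open>mat_b q\<close> and of their finite images thus reduce to
  adding exponents.\<close>

lemma (in group) int_pow_additive:
  fixes f :: "int \<Rightarrow> 'a"
  assumes closed: "\<And>x. f x \<in> carrier G" and add: "\<And>x y. f (x + y) = f x \<otimes> f y"
  shows "f 1 [^] n = f n"
proof -
  have zero: "f 0 = \<one>"
    using add[of 0 0] closed[of 0] by (metis add_0 l_cancel_one')
  have nat: "f 1 [^] k = f (int k)" for k :: nat
    by (induction k) (simp_all add: zero add[symmetric] add.commute)
  have neg: "inv (f x) = f (- x)" for x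
    using add[of "- x" x] zero closed by (intro inv_equality) simp_all
  show ?thesis
    by (cases n rule: int_cases2) (simp_all add: int_pow_int nat int_pow_neg closed neg)
qed

section \<open>Unipotent matrices in SL2 and their powers\<close>

definition mat_low :: "complex \<Rightarrow> complex^2^2" where
  "mat_low c = vector [vector [1, 0], vector [c, 1]]"

lemma mat2_eq_iff:
  fixes A B :: "'a^2^2"
  shows "A = B \<longleftrightarrow> A$1$1 = B$1$1 \<and> A$1$2 = B$1$2 \<and> A$2$1 = B$2$1 \<and> A$2$2 = B$2$2"
  by (auto simp: vec_eq_iff forall_2)

lemma mat2_mult [simp]:
  fixes A B :: "'a::semiring_1^2^2"
  shows "(A ** B)$i$j = A$i$1 * B$1$j + A$i$2 * B$2$j"
  by (simp add: matrix_matrix_mult_def sum_2)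

lemma mat_entries [simp]:
  "mat_low c $ 1 $ 1 = 1" "mat_low c $ 1 $ 2 = 0" "mat_low c $ 2 $ 1 = c" "mat_low c $ 2 $ 2 = 1"
  "mat_b q $ 1 $ 1 = 1" "mat_b q $ 1 $ 2 = q" "mat_b q $ 2 $ 1 = 0" "mat_b q $ 2 $ 2 = 1"
  by (simp_all add: mat_low_def mat_b_def)

lemma mat_a_eq_low: "mat_a = mat_low 1"
  by (simp add: mat_a_def mat_low_def)

lemma SL2_simps [simp]:
  "x \<otimes>\<^bsub>SL2\<^esub> y = x ** y" "\<one>\<^bsub>SL2\<^esub> = mat 1" "x \<in> carrier SL2 \<longleftrightarrow> det x = 1"
  by (simp_all add: SL2_def)

lemma mat_a_int_pow: "mat_a [^]\<^bsub>SL2\<^esub> (n::int) = mat_low (of_int n)"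
  using group.int_pow_additive[OF group_SL2, of "\<lambda>n. mat_low (of_int n)" n]
  by (simp add: mat_a_eq_low det_2 mat2_eq_iff)

lemma mat_b_int_pow: "mat_b q [^]\<^bsub>SL2\<^esub> (n::int) = mat_b (of_int n * q)"
  using group.int_pow_additive[OF group_SL2, of "\<lambda>n. mat_b (of_int n * q)" n]
  by (simp add: det_2 mat2_eq_iff algebra_simps)

section \<open>Universal property and Hopfian argument\<close>

text \<open>The universal property of the free group. Words are evaluated letter by letter, and
  multiplicativity holds because a cancelled pair \<open>l\<close>, \<open>inv_letter l\<close>
  evaluates to the identity.\<close>

lemma free_group_hom:
  assumes "group H" and h: "\<And>x. x \<in> X \<Longrightarrow> h x \<in> carrier H"
  obtains \<phi> where "\<phi> \<in> hom (free_group X) H" "\<And>x. x \<in> X \<Longrightarrow> \<phi> [(x, True)] = h x"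
proof -
  interpret H: group H by fact
  define val where "val l = (if snd l then h (fst l) else inv\<^bsub>H\<^esub> h (fst l))" for l
  define \<phi> where "\<phi> w = foldr (\<lambda>l y. val l \<otimes>\<^bsub>H\<^esub> y) w \<one>\<^bsub>H\<^esub>" for w
  have val: "val l \<in> carrier H" if "fst l \<in> X" for l
    using h[OF that] by (simp add: val_def)
  have closed: "\<phi> w \<in> carrier H" if "fst ` set w \<subseteq> X" for w
    using that by (induction w) (auto simp: \<phi>_def val)
  have inv: "val l \<otimes>\<^bsub>H\<^esub> (val (inv_letter l) \<otimes>\<^bsub>H\<^esub> y) = y" if "fst l \<in> X" "y \<in> carrier H" for l y
    using h[OF that(1)] that(2) by (auto simp: val_def inv_letter_def H.m_assoc[symmetric])
  have cons: "\<phi> (cons_reduce l w) = val l \<otimes>\<^bsub>H\<^esub> \<phi> w" if "fst l \<in> X" "fst ` set w \<subseteq> X" for l w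
  proof (cases w)
    case Nil
    then show ?thesis by (simp add: \<phi>_def)
  next
    case (Cons l' w')
    then show ?thesis
      using inv[OF that(1), of "\<phi> w'"] closed[of w'] that by (auto simp: \<phi>_def)
  qed
  have app: "\<phi> (foldr cons_reduce u v) = \<phi> u \<otimes>\<^bsub>H\<^esub> \<phi> v"
    if "fst ` set u \<subseteq> X" "fst ` set v \<subseteq> X" for u v
    using that(1)
  proof (induction u)
    case Nil
    then show ?case using closed[OF that(2)] by (simp add: \<phi>_def)
  next
    case (Cons l u)
    have "\<phi> (foldr cons_reduce (l # u) v) = val l \<otimes>\<^bsub>H\<^esub> \<phi> (foldr cons_reduce u v)"
      using Cons.prems that(2) cons[OF _ order_trans[OF letters_foldr[of u v]], of l] by simp
    also have "\<dots> = (val l \<otimes>\<^bsub>H\<^esub> \<phi> u) \<otimes>\<^bsub>H\<^esub> \<phi> v"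
      using Cons.prems Cons.IH closed[of u] closed[OF that(2)] by (simp add: val H.m_assoc)
    finally show ?case by (simp add: \<phi>_def)
  qed
  show ?thesis
  proof
    show "\<phi> \<in> hom (free_group X) H"
      by (rule homI) (auto simp: free_group_def closed app)
    show "\<phi> [(x, True)] = h x" if "x \<in> X" for x
      using h[OF that] by (simp add: \<phi>_def val_def)
  qed
qed

lemma hom_eq_on_generate:
  assumes "group G" "group H" "f \<in> hom G H" "g \<in> hom G H" "A \<subseteq> carrier G"
    and eq: "\<And>x. x \<in> A \<Longrightarrow> f x = g x" and x: "x \<in> generate G A"
  shows "f x = g x"
proof -
  interpret G: group G by fact
  interpret f: group_hom G H f using assms by (simp add: group_hom_def group_hom_axioms_def)
  interpret g: group_hom G H g using assms by (simp add: group_hom_def group_hom_axioms_def)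
  from x show ?thesis
  proof (induction rule: generate.induct)
    case (inv h)
    then show ?case using eq[OF inv] \<open>A \<subseteq> carrier G\<close> by auto
  next
    case (eng h1 h2)
    then show ?case using G.generate_in_carrier[OF \<open>A \<subseteq> carrier G\<close>] by auto
  qed (use eq in auto)
qed

text \<open>The Hopf property in a weak form: since finitely many homomorphisms into a finite group are
  parametrised by their values on either generating pair, every pair of values is attained on
  \<open>a\<close>, \<open>b\<close> too.\<close>

lemma rank_two_free_hom_exists:
  assumes "group G" and free: "rank_two_free G" and gen: "carrier G = generate G {a, b}"
    and H: "group H" "finite (carrier H)" and PQ: "P \<in> carrier H" "Q \<in> carrier H"
  obtains f where "f \<in> hom G H" "f a = P" "f b = Q"
proof -
  interpret G: group G by fact
  have ab: "a \<in> carrier G" "b \<in> carrier G"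
    unfolding gen by (auto intro: generate.incl)
  define F where "F = free_group {1, 2 :: nat}"
  obtain \<theta> where \<theta>: "\<theta> \<in> iso G F"
    using free unfolding rank_two_free_def is_iso_def F_def by auto
  define x where "x i = inv_into (carrier G) \<theta> [(i, True)]" for i
  have x: "x i \<in> carrier G \<and> \<theta> (x i) = [(i, True)]" if "i \<in> {1, 2}" for i
  proof -
    have "[(i, True)] \<in> \<theta> ` carrier G"
      using \<theta> that unfolding iso_def bij_betw_def F_def by (auto simp: free_group_def)
    then show ?thesis unfolding x_def by (auto intro: inv_into_into f_inv_into_f)
  qed
  define C where "C = carrier H \<times> carrier H"
  have "\<exists>f. f \<in> hom G H \<and> f (x 1) = fst c \<and> f (x 2) = snd c" if "c \<in> C" for c
  proof -
    define h where "h i = (if i = 1 then fst c else snd c)" for i :: nat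
    have "h i \<in> carrier H" if "i \<in> {1, 2}" for i
      using \<open>c \<in> C\<close> by (auto simp: h_def C_def)
    then obtain \<phi> where \<phi>: "\<phi> \<in> hom F H" "\<And>i. i \<in> {1, 2} \<Longrightarrow> \<phi> [(i, True)] = h i"
      using free_group_hom[OF H(1)] unfolding F_def by metis
    have "\<phi> \<circ> \<theta> \<in> hom G H"
      using \<theta> \<phi>(1) by (auto simp: iso_def intro: hom_compose)
    then show ?thesis using \<phi>(2) x by (intro exI[of _ "\<phi> \<circ> \<theta>"]) (auto simp: h_def)
  qed
  then obtain \<Phi> where \<Phi>: "\<And>c. c \<in> C \<Longrightarrow> \<Phi> c \<in> hom G H \<and> \<Phi> c (x 1) = fst c \<and> \<Phi> c (x 2) = snd c"
    by metis
  \<comment> \<open>\<open>E\<close> converts values on the free basis \<open>x 1\<close>,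
    \<open>x 2\<close> into values on \<open>a\<close>, \<open>b\<close>. It is injective because
    \<open>a\<close> and \<open>b\<close> generate \<open>G\<close>, hence surjective on the finite
    set \<open>C\<close>.\<close>
  define E where "E c = (\<Phi> c a, \<Phi> c b)" for c
  have "inj_on E C"
  proof (rule inj_onI)
    fix c d assume cd: "c \<in> C" "d \<in> C" "E c = E d"
    have "\<Phi> c y = \<Phi> d y" if "y \<in> carrier G" for y
    proof (rule hom_eq_on_generate[OF assms(1) H(1)])
      show "\<Phi> c \<in> hom G H" "\<Phi> d \<in> hom G H" using \<Phi> cd by auto
      show "{a, b} \<subseteq> carrier G" using ab by simp
      show "\<Phi> c z = \<Phi> d z" if "z \<in> {a, b}" for z
        using cd(3) that by (auto simp: E_def)
      show "y \<in> generate G {a, b}" using that gen by simp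
    qed
    then show "c = d" using \<Phi>[OF cd(1)] \<Phi>[OF cd(2)] x by (auto simp: prod_eq_iff)
  qed
  moreover have "E ` C \<subseteq> C"
    using \<Phi> ab unfolding E_def C_def by (auto simp: hom_def Pi_def)
  ultimately have "E ` C = C"
    using H(2) by (intro endo_inj_surj) (auto simp: C_def)
  moreover have "(P, Q) \<in> C" using PQ by (simp add: C_def)
  ultimately have "(P, Q) \<in> E ` C" by simp
  then obtain c where c: "c \<in> C" "E c = (P, Q)" by auto
  then show ?thesis using \<Phi>[OF c(1)] that[of "\<Phi> c"] by (auto simp: E_def)
qed

subsection \<open>Step relation numbers are relation numbers\<close>

text \<open>A quadruple \<open>(A, B, C, D)\<close> stands for the integer matrix with rows \<open>(A, B)\<close> and \<open>(C, D)\<close>.\<close>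

definition mod_act :: "int \<Rightarrow> int \<times> int \<times> int \<times> int \<Rightarrow> int \<times> int \<Rightarrow> int \<times> int" where
  "mod_act N = (\<lambda>(A, B, C, D). \<lambda>(x, y) \<in> {0..<N} \<times> {0..<N}. ((A * x + B * y) mod N, (C * x + D * y) mod N))"

definition mul4 :: "int \<times> int \<times> int \<times> int \<Rightarrow> int \<times> int \<times> int \<times> int \<Rightarrow> int \<times> int \<times> int \<times> int" where
  "mul4 = (\<lambda>(A, B, C, D) (A', B', C', D'). (A * A' + B * C', A * B' + B * D', C * A' + D * C', C * B' + D * D'))"

definition det4 :: "int \<times> int \<times> int \<times> int \<Rightarrow> int" where
  "det4 = (\<lambda>(A, B, C, D). A * D - B * C)"

lemma mod_act_mul4:
  assumes "N > 0"
  shows "compose ({0..<N} \<times> {0..<N}) (mod_act N M) (mod_act N M') = mod_act N (mul4 M M')"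
proof -
  obtain A B C D where M: "M = (A, B, C, D)" by (cases M)
  obtain A' B' C' D' where M': "M' = (A', B', C', D')" by (cases M')
  have *: "(a * (z mod N) + b * (w mod N)) mod N = (a * z + b * w) mod N" for a b z w
    by (metis mod_add_eq mod_mult_right_eq)
  show ?thesis
    using assms
    by (intro ext) (auto simp: M M' mod_act_def mul4_def compose_def * algebra_simps restrict_def)
qed

text \<open>The adjugate matrix provides the inverse map. The permutations of pairs of residues
  serve as the finite group into which SL2 of the integers is mapped by reduction modulo
  \<open>N\<close>.\<close>

lemma mod_act_in_Bij:
  assumes "N > 0" "det4 M = 1"
  shows "mod_act N M \<in> Bij ({0..<N} \<times> {0..<N})"
proof -
  obtain A B C D where M: "M = (A, B, C, D)" by (cases M)
  define M' where "M' = (D, - B, - C, A)"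
  have maps: "mod_act N K \<in> {0..<N} \<times> {0..<N} \<rightarrow> {0..<N} \<times> {0..<N}" for K
    using assms(1) by (cases K) (auto simp: mod_act_def)
  have 1: "mul4 M M' = (1, 0, 0, 1)" "mul4 M' M = (1, 0, 0, 1)"
    using assms(2) by (auto simp: M M'_def mul4_def det4_def algebra_simps)
  have id: "mod_act N (1, 0, 0, 1) v = v" if "v \<in> {0..<N} \<times> {0..<N}" for v
    using that by (cases v) (auto simp: mod_act_def)
  have "bij_betw (mod_act N M) ({0..<N} \<times> {0..<N}) ({0..<N} \<times> {0..<N})"
    using maps mod_act_mul4[OF assms(1), of M M'] mod_act_mul4[OF assms(1), of M' M] id 1
    by (intro bij_betwI[where g = "mod_act N M'"]) (auto simp: compose_def fun_eq_iff restrict_def split: if_splits)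
  moreover have "mod_act N M \<in> extensional ({0..<N} \<times> {0..<N})"
    by (simp add: M mod_act_def)
  ultimately show ?thesis by (simp add: Bij_def)
qed

lemma BijGroup_mod_act_mult:
  assumes "N > 0" "det4 M = 1" "det4 M' = 1"
  shows "mod_act N M \<otimes>\<^bsub>BijGroup ({0..<N} \<times> {0..<N})\<^esub> mod_act N M' = mod_act N (mul4 M M')"
  using assms by (simp add: BijGroup_def mod_act_in_Bij mod_act_mul4)

lemma det4_mul4: "det4 (mul4 M M') = det4 M * det4 M'"
  by (auto simp: det4_def mul4_def algebra_simps split: prod.splits)

section \<open>Alternating words in a and b_4\<close>

definition low4 :: "int \<Rightarrow> int \<times> int \<times> int \<times> int" where "low4 n = (1, 0, n, 1)"
text \<open>This is the n-th power of b_4. The factor 4 is what makes the growth estimate for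
  alternating words go through.\<close>

definition upp4 :: "int \<Rightarrow> int \<times> int \<times> int \<times> int" where "upp4 n = (1, 4 * n, 0, 1)"

lemma det4_low_upp [simp]: "det4 (low4 n) = 1" "det4 (upp4 n) = 1"
  by (simp_all add: det4_def low4_def upp4_def)

lemma mul4_low_upp: "mul4 (low4 n) (low4 n') = low4 (n + n')" "mul4 (upp4 n) (upp4 n') = upp4 (n + n')"
  by (simp_all add: mul4_def low4_def upp4_def)

lemma mod_act_in_BijGroup:
  assumes "N > 0" "det4 M = 1"
  shows "mod_act N M \<in> carrier (BijGroup ({0..<N} \<times> {0..<N}))"
  using mod_act_in_Bij[OF assms] by (simp add: BijGroup_def)

lemma mod_act_int_pow:
  assumes "N > 0"
  shows "mod_act N (low4 1) [^]\<^bsub>BijGroup ({0..<N} \<times> {0..<N})\<^esub> (n::int) = mod_act N (low4 n)"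
    and "mod_act N (upp4 1) [^]\<^bsub>BijGroup ({0..<N} \<times> {0..<N})\<^esub> (n::int) = mod_act N (upp4 n)"
  using group.int_pow_additive[OF group_BijGroup, of "\<lambda>n. mod_act N (low4 n)" "{0..<N} \<times> {0..<N}" n]
    group.int_pow_additive[OF group_BijGroup, of "\<lambda>n. mod_act N (upp4 n)" "{0..<N} \<times> {0..<N}" n]
  by (simp_all add: assms BijGroup_mod_act_mult mod_act_in_BijGroup mul4_low_upp)

fun alt4 :: "(nat \<Rightarrow> int) \<Rightarrow> nat \<Rightarrow> int \<times> int \<times> int \<times> int" where
  "alt4 m 0 = upp4 (m 1)"
| "alt4 m (Suc k) = mul4 (mul4 (alt4 m k) (low4 (m (2 * k + 2)))) (upp4 (m (2 * k + 3)))"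

lemma det4_alt4 [simp]: "det4 (alt4 m k) = 1"
  by (induction k) (simp_all add: det4_mul4)

text \<open>A ping-pong estimate on the first row. From |B| > 2|A| and n \<noteq> 0, the new entry
  A' = A + B n satisfies 2|A'| > |B|. Then n' \<noteq> 0 gives |4 n' A' + B| \<ge> 4|A'| - |B| >
  2|A'|. In particular the upper right entry never vanishes.\<close>

lemma alt4_growth:
  assumes "\<forall>i \<in> {1..2 * k + 1}. m i \<noteq> 0"
  shows "case alt4 m k of (A, B, C, D) \<Rightarrow> A \<noteq> 0 \<and> \<bar>B\<bar> > 2 * \<bar>A\<bar>"
  using assms
proof (induction k)
  case 0
  then have "\<bar>m 1\<bar> \<ge> 1" by auto
  then show ?case by (auto simp: upp4_def)
next
  case (Suc k)
  obtain A B C D where ABCD: "alt4 m k = (A, B, C, D)" by (cases "alt4 m k")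
  have AB: "A \<noteq> 0" "\<bar>B\<bar> > 2 * \<bar>A\<bar>" using Suc by (auto simp: ABCD)
  define n n' where "n = m (2 * k + 2)" and "n' = m (2 * k + 3)"
  have "n \<noteq> 0" "n' \<noteq> 0" using Suc.prems by (auto simp: n_def n'_def)
  then have n: "\<bar>n\<bar> \<ge> 1" "\<bar>n'\<bar> \<ge> 1" by auto
  define A' where "A' = A + B * n"
  have "\<bar>B\<bar> * 1 \<le> \<bar>B\<bar> * \<bar>n\<bar>" by (rule mult_left_mono) (use n in auto)
  then have "\<bar>B\<bar> \<le> \<bar>B * n\<bar>" by (simp add: abs_mult)
  moreover have "\<bar>B * n\<bar> \<le> \<bar>A'\<bar> + \<bar>A\<bar>" unfolding A'_def by arith
  ultimately have A': "2 * \<bar>A'\<bar> > \<bar>B\<bar>" using AB by linarith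
  have "\<bar>A'\<bar> * 1 \<le> \<bar>A'\<bar> * \<bar>n'\<bar>" by (rule mult_left_mono) (use n in auto)
  then have "4 * \<bar>A'\<bar> \<le> \<bar>A' * (4 * n')\<bar>" by (simp add: abs_mult)
  moreover have "\<bar>A' * (4 * n')\<bar> \<le> \<bar>A' * (4 * n') + B\<bar> + \<bar>B\<bar>" by arith
  ultimately have "\<bar>A' * (4 * n') + B\<bar> > 2 * \<bar>A'\<bar>"
    using A' AB by linarith
  moreover have "alt4 m (Suc k) = (A', A' * (4 * n') + B, C + D * n, (C + D * n) * (4 * n') + D)"
    by (simp add: ABCD mul4_def low4_def upp4_def n_def n'_def A'_def)
  ultimately show ?case using A' AB by auto
qed

section \<open>The group \<open>Gq q\<close> and the relation given by a lower-triangular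
  word\<close>

lemma group_Gq: "group (Gq q)"
  unfolding Gq_def
  by (rule group.subgroup_imp_group[OF group_SL2 group.generate_is_subgroup[OF group_SL2]])
    (use mat_a_in_SL2 mat_b_in_SL2 in auto)

lemma carrier_Gq_eq_generate: "carrier (Gq q) = generate (Gq q) {mat_a, mat_b q}"
proof -
  have sub: "subgroup (generate SL2 {mat_a, mat_b q}) SL2"
    by (rule group.generate_is_subgroup[OF group_SL2]) (use mat_a_in_SL2 mat_b_in_SL2 in auto)
  have "generate (SL2\<lparr>carrier := generate SL2 {mat_a, mat_b q}\<rparr>) {mat_a, mat_b q}
      = generate SL2 {mat_a, mat_b q}"
    by (rule group.generate_consistent[OF group_SL2 _ sub]) (auto intro: generate.incl)
  then show ?thesis by (simp add: Gq_def)
qed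

lemma mat_in_Gq: "mat_a \<in> carrier (Gq q)" "mat_b q \<in> carrier (Gq q)"
  by (auto simp: Gq_def intro: generate.incl)

lemma Gq_int_pow:
  assumes "x \<in> carrier (Gq q)"
  shows "x [^]\<^bsub>SL2\<^esub> (n::int) = x [^]\<^bsub>Gq q\<^esub> n"
  using group.int_pow_consistent[OF group_SL2 group.generate_is_subgroup[OF group_SL2], of "{mat_a, mat_b q}" x n]
    assms mat_a_in_SL2 mat_b_in_SL2
  by (simp add: Gq_def)

text \<open>Carries a word in \<open>mat_a\<close> and \<open>mat_b q\<close> to the word with the
  same exponents in a and b_4 modulo \<open>N\<close>, where the upper right entry can be
  controlled.\<close>

lemma alt_word_hom:
  assumes f: "f \<in> hom (Gq q) (BijGroup ({0..<N} \<times> {0..<N}))" and N: "N > 0"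
    and fab: "f mat_a = mod_act N (low4 1)" "f (mat_b q) = mod_act N (upp4 1)"
  shows "alt_word q m k \<in> carrier (Gq q) \<and> f (alt_word q m k) = mod_act N (alt4 m k)"
proof -
  interpret G: group "Gq q" by (rule group_Gq)
  interpret f: group_hom "Gq q" "BijGroup ({0..<N} \<times> {0..<N})" f
    using f by (simp add: group_hom_def group_hom_axioms_def group_Gq group_BijGroup)
  have mult: "x \<otimes>\<^bsub>SL2\<^esub> y = x \<otimes>\<^bsub>Gq q\<^esub> y" for x y by (simp add: Gq_def)
  have pw: "f (mat_a [^]\<^bsub>Gq q\<^esub> n) = mod_act N (low4 n)"
    "f (mat_b q [^]\<^bsub>Gq q\<^esub> n) = mod_act N (upp4 n)" for n :: int
    using f.hom_int_pow[OF mat_in_Gq(1)] f.hom_int_pow[OF mat_in_Gq(2)]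
    by (simp_all add: fab mod_act_int_pow N)
  show ?thesis
    by (induction k)
      (simp_all add: mult Gq_int_pow[where q = q] mat_in_Gq pw BijGroup_mod_act_mult N det4_mul4 del: SL2_simps)
qed

text \<open>Conjugating \<open>mat_a\<close> by a lower-triangular matrix gives a lower unipotent
  matrix, and these commute with each other. The equation \<open>X ** L = L ** mat_a\<close>
  expresses that \<open>X\<close> is this conjugate without mentioning an inverse.\<close>

lemma lower_triangular_commute:
  fixes L X :: "complex^2^2"
  assumes "lower_triangular L" "det L = 1" "X ** L = L ** mat_a"
  shows "X ** mat_a = mat_a ** X"
proof -
  have L: "L$1$2 = 0" "L$1$1 * L$2$2 = 1"
    using assms by (auto simp: lower_triangular_def det_2)
  have *: "X$1$1 * L$1$1 = L$1$1" "X$1$2 * L$2$2 = 0" "X$2$2 * L$2$2 = L$2$2"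
    using assms(3) L by (auto simp: mat2_eq_iff mat_a_eq_low)
  have nz: "L$1$1 \<noteq> 0" "L$2$2 \<noteq> 0" using L(2) by auto
  show ?thesis
    using * nz L by (auto simp: mat2_eq_iff mat_a_eq_low)
qed

lemma relation_number_if_step_relation_number:
  assumes "step_relation_number l q"
  shows "relation_number q"
  unfolding relation_number_def
proof
  assume free: "rank_two_free (Gq q)"
  interpret G: group "Gq q" by (rule group_Gq)
  obtain k m where m: "\<forall>i \<in> {1..2 * k + 1}. m i \<noteq> 0" and low: "lower_triangular (alt_word q m k)"
    using assms unfolding step_relation_number_def by auto
  obtain A B C D where W: "alt4 m k = (A, B, C, D)" by (cases "alt4 m k")
  \<comment> \<open>This modulus exceeds B^2, so it cannot divide B^2 when B \<noteq> 0; the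
    commutation relation will force exactly that divisibility.\<close>
  define N where "N = B\<^sup>2 + 1"
  have N: "N > 0" unfolding N_def by (simp add: add_nonneg_pos)
  have B: "B \<noteq> 0" and det: "A * D - B * C = 1"
    using alt4_growth[OF m] det4_alt4[of m k] by (auto simp: W det4_def)
  define S where "S = {0..<N} \<times> {0..<N}"
  have fin: "finite (carrier (BijGroup S))"
  proof (rule finite_subset)
    show "carrier (BijGroup S) \<subseteq> S \<rightarrow>\<^sub>E S"
      by (auto simp: BijGroup_def Bij_def PiE_def bij_betw_def)
    show "finite (S \<rightarrow>\<^sub>E S)" by (intro finite_PiE) (auto simp: S_def)
  qed
  obtain f where f: "f \<in> hom (Gq q) (BijGroup S)"
    and fab: "f mat_a = mod_act N (low4 1)" "f (mat_b q) = mod_act N (upp4 1)"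
    by (rule rank_two_free_hom_exists[OF group_Gq free carrier_Gq_eq_generate group_BijGroup fin,
        of "mod_act N (low4 1)" "mod_act N (upp4 1)"])
      (auto simp: BijGroup_def S_def mod_act_in_Bij N)
  define w where "w = alt_word q m k"
  have w: "w \<in> carrier (Gq q)" "f w = mod_act N (alt4 m k)"
    using alt_word_hom[OF _ N fab, of m k] f unfolding S_def w_def by auto
  define X where "X = w \<otimes>\<^bsub>Gq q\<^esub> mat_a \<otimes>\<^bsub>Gq q\<^esub> inv\<^bsub>Gq q\<^esub> w"
  have X: "X \<in> carrier (Gq q)" using w mat_in_Gq by (simp add: X_def)
  have Xw: "X \<otimes>\<^bsub>Gq q\<^esub> w = w \<otimes>\<^bsub>Gq q\<^esub> mat_a"
    using w mat_in_Gq by (simp add: X_def G.m_assoc)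
  have "carrier (Gq q) \<subseteq> carrier SL2"
    using group.generate_incl[OF group_SL2, of "{mat_a, mat_b q}"] mat_a_in_SL2 mat_b_in_SL2
    by (simp add: Gq_def)
  then have "det w = 1" using w(1) by auto
  then have comm: "X \<otimes>\<^bsub>Gq q\<^esub> mat_a = mat_a \<otimes>\<^bsub>Gq q\<^esub> X"
    using lower_triangular_commute[of w X] low Xw by (simp add: w_def Gq_def)
  have hom: "f (x \<otimes>\<^bsub>Gq q\<^esub> y) v = f x (f y v)"
    if "x \<in> carrier (Gq q)" "y \<in> carrier (Gq q)" "v \<in> S" for x y v
    using hom_mult[OF f that(1,2)] hom_in_carrier[OF f that(1)] hom_in_carrier[OF f that(2)] that(3)
    by (simp add: BijGroup_def compose_def)
  define P where "P = mod_act N (low4 1)"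
  define V where "V = mod_act N (A, B, C, D)"
  have XV: "f X (V v) = V (P v)" if "v \<in> S" for v
    using hom[OF X w(1) that] hom[OF w(1) mat_in_Gq(1) that] Xw by (simp add: fab w W V_def P_def)
  have XP: "f X (P v) = P (f X v)" if "v \<in> S" for v
    using hom[OF X mat_in_Gq(1) that] hom[OF mat_in_Gq(1) X that] comm by (simp add: fab P_def)
  have modred: "(a * (z mod N) + b * (w mod N)) mod N = (a * z + b * w) mod N" for a b z w
    by (metis mod_add_eq mod_mult_right_eq)
  have N2: "N \<ge> 2" using B unfolding N_def by (smt (verit) zero_less_power2)
  have Vv: "V (x mod N, y mod N) = ((A * x + B * y) mod N, (C * x + D * y) mod N)" for x y
    using N by (simp add: V_def mod_act_def modred)
  have Pv: "P (x mod N, y mod N) = (x mod N, (x + y) mod N)" for x y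
    using N by (simp add: P_def low4_def mod_act_def mod_add_eq)
  have inS: "(x mod N, y mod N) \<in> S" for x y using N by (simp add: S_def)
  \<comment> \<open>The column (-B, A) is the preimage of (0, 1) under \<open>V\<close>. Hence the
    conjugate \<open>f X\<close> can be evaluated at (0, 1) without computing an inverse.\<close>
  have e: "V (- B mod N, A mod N) = (0 mod N, 1 mod N)"
    using det by (simp add: Vv algebra_simps)
  have "f X (0 mod N, 1 mod N) = V (P (- B mod N, A mod N))"
    using XV[OF inS] e by metis
  also have "\<dots> = ((- (B * B)) mod N, (1 - B * D) mod N)"
    using det by (simp add: Pv Vv algebra_simps)
  finally have X1: "f X (0 mod N, 1 mod N) = ((- (B * B)) mod N, (1 - B * D) mod N)" .
  \<comment> \<open>\<open>P\<close> sends (x, y) to (x, x + y), so it fixes (0, 1). Since it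
    commutes with \<open>f X\<close>, it also fixes the image of (0, 1), which makes the first
    coordinate -B^2 of that image zero modulo N.\<close>
  have "P (0 mod N, 1 mod N) = (0 mod N, 1 mod N)"
    by (simp only: Pv) simp
  then have "P ((- (B * B)) mod N, (1 - B * D) mod N) = ((- (B * B)) mod N, (1 - B * D) mod N)"
    using XP[OF inS, of 0 1] X1 by metis
  then have "(- (B * B) + (1 - B * D)) mod N = (1 - B * D) mod N"
    by (simp only: Pv prod.inject)
  then have "N dvd B * B"
    by (simp add: mod_eq_dvd_iff)
  then have "N \<le> B * B" using B by (intro zdvd_imp_le) (auto simp: zero_less_mult_iff)
  then show False by (simp add: N_def power2_eq_square)
qed

subsection \<open>Two-step relations from divisors\<close>

text \<open>Odd positions hold the exponents of b. Multiplying them by \<open>p\<close> compensates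
  for dividing \<open>q\<close> by \<open>p\<close>, because the m-th power of
  \<open>mat_b q\<close> depends only on m q.\<close>

lemma alt_word_rescale:
  assumes "p \<noteq> 0"
  shows "alt_word (q / of_int p) (\<lambda>i. if odd i then p * m i else m i) k = alt_word q m k"
  by (induction k) (simp_all add: mat_b_int_pow assms del: SL2_simps)

lemma step_relation_number_divide:
  assumes "step_relation_number l q" "p \<noteq> 0"
  shows "step_relation_number l (q / of_int p)"
proof -
  obtain k m where "k \<le> l" "\<forall>i \<in> {1..2 * k + 1}. m i \<noteq> 0" "lower_triangular (alt_word q m k)"
    using assms unfolding step_relation_number_def by auto
  then show ?thesis
    using assms(2) unfolding step_relation_number_def
    by (intro exI[of _ k] conjI exI[of _ "\<lambda>i. if odd i then p * m i else m i"])
      (auto simp: alt_word_rescale)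
qed

text \<open>Up to a nonzero factor, \<open>(c, q * e)\<close> is the first row of the partial product to which the
  remaining exponents are still to be applied; clearing the denominator of \<open>q = s / r\<close> keeps
  \<open>c\<close> and \<open>e\<close> integral.\<close>

fun closes :: "int \<Rightarrow> int \<Rightarrow> int list \<Rightarrow> int \<Rightarrow> int \<Rightarrow> bool" where
  "closes s r [] c e \<longleftrightarrow> False"
| "closes s r [m] c e \<longleftrightarrow> e + m * c = 0"
| "closes s r (m # n # ms) c e \<longleftrightarrow> closes s r ms (r * c + s * n * (e + m * c)) (r * (e + m * c))"

text \<open>\<open>P k\<close> is the product of all factors before the b-power with exponent
  \<open>m (2 * k + 1)\<close>. The invariant is that \<kappa> times its first row equals (c, q e);
  each round multiplies \<kappa> by \<open>r\<close>, so that \<open>r * q = s\<close> removes the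
  denominator.\<close>

lemma closes_lower_triangular:
  fixes P :: "nat \<Rightarrow> complex^2^2"
  assumes P: "\<And>k. alt_word q m k = P k ** mat_b (of_int (m (2 * k + 1)) * q)"
      "\<And>k. P (Suc k) = alt_word q m k ** mat_low (of_int (m (2 * k + 2)))"
  assumes "closes s r ms c e" "r \<noteq> 0" "q = of_int s / of_int r"
    and "length ms = Suc (2 * j)" "\<And>i. i < length ms \<Longrightarrow> m (2 * k + 1 + i) = ms ! i"
    and "\<kappa> \<noteq> 0" "\<kappa> * P k $ 1 $ 1 = of_int c" "\<kappa> * P k $ 1 $ 2 = q * of_int e"
  shows "lower_triangular (alt_word q m (k + j))"
  using assms(3-)
proof (induction s r ms c e arbitrary: j k \<kappa> rule: closes.induct)
  case (2 s r m' c e)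
  have m': "m (2 * k + 1) = m'" using 2(5)[of 0] by simp
  have "\<kappa> * (alt_word q m k $ 1 $ 2) = \<kappa> * P k $ 1 $ 1 * (of_int m' * q) + \<kappa> * P k $ 1 $ 2"
    unfolding P(1) m' by (simp add: algebra_simps)
  also have "\<dots> = q * of_int (e + m' * c)"
    unfolding 2(7,8) by (simp add: algebra_simps)
  also have "\<dots> = 0" using 2(1) by (simp only: closes.simps of_int_0 mult_zero_right)
  finally show ?case using 2(4,6) by (simp add: lower_triangular_def)
next
  case (3 s r m' n ms c e)
  obtain j' where j: "j = Suc j'" using 3(5) by (cases j) auto
  have m': "m (2 * k + 1) = m'" "m (2 * k + 2) = n"
    using 3(6)[of 0] 3(6)[of 1] by simp_all
  let ?W = "alt_word q m k"
  have W: "\<kappa> * ?W $ 1 $ 1 = of_int c" "\<kappa> * ?W $ 1 $ 2 = q * of_int (e + m' * c)"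
  proof -
    show "\<kappa> * ?W $ 1 $ 1 = of_int c" using 3(8) by (simp add: P(1))
    have "\<kappa> * ?W $ 1 $ 2 = (\<kappa> * P k $ 1 $ 1) * (of_int m' * q) + \<kappa> * P k $ 1 $ 2"
      unfolding P(1) m' by (simp add: algebra_simps)
    then show "\<kappa> * ?W $ 1 $ 2 = q * of_int (e + m' * c)"
      unfolding 3(8,9) by (simp add: algebra_simps)
  qed
  have rq: "of_int r * q = of_int s" using 3(3,4) by simp
  have "lower_triangular (alt_word q m (Suc k + j'))"
  proof (rule "3.IH"[where \<kappa> = "of_int r * \<kappa>"])
    show "of_int r * \<kappa> * P (Suc k) $ 1 $ 1 = of_int (r * c + s * n * (e + m' * c))"
    proof -
      have "of_int r * \<kappa> * P (Suc k) $ 1 $ 1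
          = of_int r * (\<kappa> * ?W $ 1 $ 1) + of_int r * of_int n * (\<kappa> * ?W $ 1 $ 2)"
        unfolding P(2) m' by (simp add: algebra_simps)
      also have "\<dots> = of_int r * of_int c + (of_int r * q) * of_int n * of_int (e + m' * c)"
        unfolding W by (simp add: algebra_simps)
      finally show ?thesis unfolding rq by simp
    qed
    show "of_int r * \<kappa> * P (Suc k) $ 1 $ 2 = q * of_int (r * (e + m' * c))"
    proof -
      have "of_int r * \<kappa> * P (Suc k) $ 1 $ 2 = of_int r * (\<kappa> * ?W $ 1 $ 2)"
        by (simp add: P(2))
      then show ?thesis unfolding W by simp
    qed
    show "m (2 * Suc k + 1 + i) = ms ! i" if "i < length ms" for i
      using 3(6)[of "Suc (Suc i)"] that by simp
  qed (use 3 j in simp_all)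
  then show ?case by (simp add: j)
qed simp

lemma step_relation_number_if_closes:
  assumes "closes s r ms 1 0" "r \<noteq> 0" "0 \<notin> set ms" "length ms = Suc (2 * j)" "j \<le> l"
  shows "step_relation_number l (of_int s / of_int r)"
proof -
  define q :: complex where "q = of_int s / of_int r"
  \<comment> \<open>Exponents of \<open>alt_word\<close> are numbered from 1, list entries from
    0.\<close>
  define m where "m i = ms ! (i - 1)" for i
  define P where "P k = (case k of 0 \<Rightarrow> mat 1 | Suc k' \<Rightarrow> alt_word q m k' ** mat_low (of_int (m (2 * k' + 2))))" for k
  have "alt_word q m k = P k ** mat_b (of_int (m (2 * k + 1)) * q)" for k
    by (cases k) (simp_all add: P_def mat_a_int_pow mat_b_int_pow numeral_3_eq_3)
  moreover have "P (Suc k) = alt_word q m k ** mat_low (of_int (m (2 * k + 2)))" for k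
    by (simp add: P_def)
  ultimately have "lower_triangular (alt_word q m (0 + j))"
    using assms(1,2)
    by (rule closes_lower_triangular[where \<kappa> = 1]) (simp_all add: q_def m_def P_def mat_def assms)
  moreover have "m i \<noteq> 0" if "i \<in> {1..2 * j + 1}" for i
  proof -
    have "ms ! (i - 1) \<in> set ms" using that assms(4) by (intro nth_mem) auto
    then show ?thesis using assms(3) by (metis m_def)
  qed
  ultimately show ?thesis
    using assms(5) unfolding step_relation_number_def q_def by (intro exI[of _ j] conjI exI[of _ m]) auto
qed

lemma odd_length_if_closes: "closes s r ms c e \<Longrightarrow> odd (length ms)"
  by (induction s r ms c e rule: closes.induct) auto

lemma two_step_if_dvd:
  fixes s r u x \<mu> \<nu> :: int
  assumes x: "s * x = u * r - 1" "x \<noteq> 0" and dvd: "\<mu> dvd x" "\<nu> dvd x"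
    and u: "u dvd \<mu> + \<nu>" "\<mu> + \<nu> \<noteq> 0" and r: "r \<noteq> 0"
  shows "step_relation_number 2 (of_int s / of_int r)"
proof -
  obtain a b c where abc: "x = \<mu> * a" "x = \<nu> * b" "\<mu> + \<nu> = u * c"
    using dvd u(1) unfolding dvd_def by blast
  have nz: "a \<noteq> 0" "b \<noteq> 0" "c \<noteq> 0" "\<mu> \<noteq> 0" "\<nu> \<noteq> 0"
    using abc x(2) u(2) by auto
  have 1: "s * a * \<mu> = u * r - 1" "s * b * \<nu> = u * r - 1"
    unfolding x(1)[symmetric] by (subst abc(1), simp, subst abc(2), simp)
  \<comment> \<open>The pair (c, e) in \<open>closes\<close> runs from (1, 0) to (u r^2, \<mu> r^2)
    and then to (r^2, -\<nu> r^3), which the last exponent r \<nu> closes. Both simplifications of c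
    use s a \<mu> = s b \<nu> = u r - 1; the middle exponent turns \<mu> into -\<nu>.\<close>
  have C1: "r * 1 + s * a * (0 + r * \<mu> * 1) = u * r * r"
    using 1(1) by algebra
  have E1: "r * (0 + r * \<mu> * 1) + - c * (u * r * r) = - \<nu> * r * r"
    using abc(3) by algebra
  have C2: "r * (u * r * r) + s * b * (- \<nu> * r * r) = r * r"
    using 1(2) by algebra
  have "closes s r [r * \<mu>, a, - c, b, r * \<nu>] 1 0"
    unfolding closes.simps C1 E1 C2 by simp
  then show ?thesis
    by (rule step_relation_number_if_closes[where j = 2]) (use nz r in auto)
qed

text \<open>The divisors \<open>d1\<close> and \<open>x div d2\<close> of \<open>x = (u * r - 1) div s\<close> have a sum divisible by \<open>u\<close>.\<close>

lemma two_step_if_row: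
  fixes s r u d1 d2 :: int
  assumes s: "s \<noteq> 0" and r: "r \<noteq> 0" and u: "u dvd s * d1 * d2 - 1"
    and d: "s * d1 dvd u * r - 1" "s * d2 dvd u * r - 1"
    and ne: "u * r \<noteq> 1" "u * r \<noteq> 1 - s * d1 * d2"
  shows "step_relation_number 2 (of_int s / of_int r)"
proof -
  obtain y where y: "u * r - 1 = s * d2 * y" using d(2) by (auto elim: dvdE)
  define x where "x = d2 * y"
  have x: "s * x = u * r - 1" by (simp add: x_def y)
  \<comment> \<open>A common divisor of \<open>u\<close> and \<open>s * d2\<close> divides two
    consecutive integers. Coprimality later allows cancelling \<open>s * d2\<close> from
    \<open>u dvd s * d2 * (d1 + y)\<close>.\<close>
  have cop: "coprime u (s * d2)"
  proof (rule coprimeI)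
    fix c assume "c dvd u" "c dvd s * d2"
    then have "c dvd s * d1 * d2 - 1" "c dvd s * d1 * d2"
      using u by (auto intro: dvd_trans simp: mult.assoc mult.left_commute[of _ d1])
    then show "is_unit c" by (metis dvd_diffD dvd_diff_commute dvd_diff add_diff_cancel_left' diff_diff_eq2)
  qed
  show ?thesis
  proof (rule two_step_if_dvd[OF x])
    show "x \<noteq> 0" using ne(1) x by auto
    show "d1 dvd x" using d(1) s unfolding x[symmetric] by simp
    show "y dvd x" by (simp add: x_def)
    have "s * d2 * (d1 + y) = (s * d1 * d2 - 1) + u * r"
      using y by (simp add: algebra_simps)
    then have "u dvd s * d2 * (d1 + y)" using u by simp
    then show "u dvd d1 + y" using cop by (simp add: coprime_dvd_mult_right_iff)
    show "d1 + y \<noteq> 0"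
    proof
      assume "d1 + y = 0"
      then have "y = - d1" by simp
      then show False using y ne(2) by (simp add: algebra_simps)
    qed
  qed (use r in auto)
qed

subsection \<open>Covering residue classes\<close>

text \<open>A row \<open>(p, u, d1, d2)\<close> treats \<open>r = p * r'\<close> by \<open>two_step_if_row\<close> with \<open>r'\<close>, \<open>d1\<close>, \<open>d2\<close> and
  \<open>u\<close> or \<open>- u\<close>; whether it applies depends only on \<open>r\<close> modulo \<open>M * s\<close>. The exceptions are the
  values of \<open>\<bar>r\<bar>\<close> violating the last two hypotheses of that lemma; they may contain harmless
  spurious values when the division by \<open>\<bar>u\<bar>\<close> is not exact. The list \<open>ws\<close> supplies words for them. The rows and words
  below were found by a computer search.\<close>

definition row_valid :: "int \<Rightarrow> int \<Rightarrow> int \<times> int \<times> int \<times> int \<Rightarrow> bool" where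
  "row_valid s M = (\<lambda>(p, u, d1, d2). u \<noteq> 0 \<and> p \<noteq> 0 \<and> p * d1 dvd M \<and> p * d2 dvd M \<and> u dvd s * d1 * d2 - 1)"

definition row_covers :: "int \<Rightarrow> int \<Rightarrow> int \<times> int \<times> int \<times> int \<Rightarrow> bool" where
  "row_covers s r = (\<lambda>(p, u, d1, d2). p dvd r \<and>
     (let y = u * (r div p) in
       s * d1 dvd y - 1 \<and> s * d2 dvd y - 1 \<or> s * d1 dvd y + 1 \<and> s * d2 dvd y + 1))"

definition row_exceptions :: "int \<Rightarrow> int \<times> int \<times> int \<times> int \<Rightarrow> int list" where
  "row_exceptions s = (\<lambda>(p, u, d1, d2). [\<bar>p\<bar> * (1 div \<bar>u\<bar>), \<bar>p\<bar> * (\<bar>s * d1 * d2 - 1\<bar> div \<bar>u\<bar>)])"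

text \<open>An executable check. The residues modulo \<open>M * s\<close> are listed as
  \<open>r + t * s\<close>, so that those not coprime to \<open>s\<close> are dropped before running
  through \<open>t\<close>. A positive exception \<open>n\<close> with \<open>4 * n \<le> s\<close>
  needs no word because s / n \<ge> 4; the words in \<open>ws\<close> may have any odd
  length.\<close>

definition certified :: "int \<Rightarrow> int \<Rightarrow> (int \<times> int \<times> int \<times> int) list \<Rightarrow> (int \<times> int list) list \<Rightarrow> bool" where
  "certified s M R ws \<longleftrightarrow>
     s > 0 \<and> M > 0 \<and> list_all (row_valid s M) R \<and>
     list_all (\<lambda>r. \<not> coprime r s \<or>
       list_all (\<lambda>t. list_ex (row_covers s (r + t * s)) R) [0..M - 1]) [0..s - 1] \<and>
     list_all (\<lambda>n. 4 * n \<le> s \<or> \<not> coprime n s \<or> list_ex (\<lambda>(n', w). n' = n) ws) (concat (map (row_exceptions s) R)) \<and>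
     list_all (\<lambda>(n, w). closes s n w 1 0 \<and> 0 \<notin> set w) ws"

lemma two_step_if_row_covers:
  assumes "row_valid s M rw" "row_covers s r rw" and s: "s > 0" and r: "r \<noteq> 0" "\<bar>r\<bar> \<notin> set (row_exceptions s rw)"
  shows "step_relation_number 2 (of_int s / of_int r)"
proof -
  obtain p u d1 d2 where rw: "rw = (p, u, d1, d2)" by (cases rw)
  have u: "u \<noteq> 0" "p \<noteq> 0" "u dvd s * d1 * d2 - 1" using assms(1) by (auto simp: row_valid_def rw)
  obtain r' where r': "r = p * r'" using assms(2) by (auto simp: row_covers_def rw)
  \<comment> \<open>The sign \<sigma> selects which of the two congruences in
    \<open>row_covers\<close> holds; \<open>\<sigma> * u\<close> then plays the role of
    \<open>u\<close>. The exceptions involve absolute values only and so do not depend on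
    it.\<close>
  obtain \<sigma> :: int where \<sigma>: "\<bar>\<sigma>\<bar> = 1" "s * d1 dvd \<sigma> * u * r' - 1" "s * d2 dvd \<sigma> * u * r' - 1"
  proof -
    consider "s * d1 dvd u * r' - 1" "s * d2 dvd u * r' - 1" | "s * d1 dvd u * r' + 1" "s * d2 dvd u * r' + 1"
      using assms(2) u by (auto simp: row_covers_def rw r' Let_def)
    then show ?thesis
    proof cases
      case 2
      have "- (u * r' + 1) = - 1 * u * r' - 1" by simp
      then have "s * d1 dvd - 1 * u * r' - 1" "s * d2 dvd - 1 * u * r' - 1"
        using 2 by (metis dvd_minus_iff)+
      then show ?thesis by (intro that[of "- 1"]) auto
    qed (auto intro: that[of 1])
  qed
  have ex: "\<bar>u\<bar> * \<bar>r'\<bar> \<noteq> 1" "\<bar>u\<bar> * \<bar>r'\<bar> \<noteq> \<bar>s * d1 * d2 - 1\<bar>"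
  proof -
    have *: "\<bar>r\<bar> \<in> set (row_exceptions s rw)" if "\<bar>u\<bar> * \<bar>r'\<bar> = 1 \<or> \<bar>u\<bar> * \<bar>r'\<bar> = \<bar>s * d1 * d2 - 1\<bar>"
    proof -
      have "\<bar>r'\<bar> = X div \<bar>u\<bar>" if "\<bar>u\<bar> * \<bar>r'\<bar> = X" for X
        using u that by auto
      then have "\<bar>r'\<bar> = 1 div \<bar>u\<bar> \<or> \<bar>r'\<bar> = \<bar>s * d1 * d2 - 1\<bar> div \<bar>u\<bar>" using that by blast
      then show ?thesis by (auto simp: row_exceptions_def rw r' abs_mult)
    qed
    show "\<bar>u\<bar> * \<bar>r'\<bar> \<noteq> 1" "\<bar>u\<bar> * \<bar>r'\<bar> \<noteq> \<bar>s * d1 * d2 - 1\<bar>" using * r(2) by auto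
  qed
  have "step_relation_number 2 (of_int s / of_int r')"
  proof (rule two_step_if_row[where u = "\<sigma> * u"])
    show "\<sigma> * u dvd s * d1 * d2 - 1" using u(3) \<sigma>(1) by (auto simp: abs_eq_iff')
    show "\<sigma> * u * r' \<noteq> 1" "\<sigma> * u * r' \<noteq> 1 - s * d1 * d2"
      using ex \<sigma>(1) by (auto simp: abs_mult[symmetric] abs_eq_iff')
  qed (use s r r' \<sigma> in auto)
  then have "step_relation_number 2 (of_int s / of_int r' / of_int p)"
    by (rule step_relation_number_divide) (use u in auto)
  then show ?thesis by (simp add: r' mult.commute)
qed

text \<open>Since \<open>p * d1\<close> and \<open>p * d2\<close> divide \<open>M\<close>, changing
  \<open>r\<close> by a multiple of \<open>M * s\<close> changes \<open>r div p\<close> by a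
  multiple of both \<open>s * d1\<close> and \<open>s * d2\<close>.\<close>

lemma row_covers_mod:
  assumes "row_valid s M rw" "row_covers s (r mod (M * s)) rw"
  shows "row_covers s r rw"
proof -
  obtain p u d1 d2 where rw: "rw = (p, u, d1, d2)" by (cases rw)
  have p: "p \<noteq> 0" "p * d1 dvd M" "p * d2 dvd M" using assms(1) by (auto simp: row_valid_def rw)
  obtain M' where M': "M = p * M'" using p(2) by (meson dvdE dvd_mult_left)
  obtain t where t: "r mod (M * s) = p * t" using assms(2) by (auto simp: row_covers_def rw)
  define k where "k = r div (M * s)"
  have "r = (M * s) * k + p * t" unfolding k_def t[symmetric] by simp
  then have "r = p * (t + M' * s * k)" by (simp add: M' algebra_simps)
  then have rp: "p dvd r" "r div p = t + M' * s * k" using p by auto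
  have d: "d1 dvd M'" "d2 dvd M'" using p M' by auto
  have "s * d dvd u * (t + M' * s * k) + c \<longleftrightarrow> s * d dvd u * t + c" if d: "d dvd M'" for d c
  proof -
    have "u * (t + M' * s * k) + c = (u * t + c) + (s * M') * (u * k)" by (simp add: algebra_simps)
    moreover have "s * d dvd (s * M') * (u * k)" using d by (intro dvd_mult2 mult_dvd_mono) auto
    ultimately show ?thesis by (metis dvd_add_left_iff)
  qed
  from this[of _ "- 1"] this[of _ 1] show ?thesis
    using assms(2) rp d p unfolding row_covers_def rw t by (simp add: Let_def)
qed

lemma certified_two_step:
  assumes "certified s M R ws" "r \<noteq> 0" "coprime r s" "\<bar>r\<bar> \<notin> set (concat (map (row_exceptions s) R))"
  shows "step_relation_number 2 (of_int s / of_int r)"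
proof -
  have s: "s > 0" "M * s > 0" using assms(1) by (auto simp: certified_def)
  \<comment> \<open>The second digit of \<open>r\<close> in mixed radix:
    \<open>r mod (M * s)\<close> equals \<open>r mod s + t * s\<close>, the form in which
    \<open>certified\<close> lists residues.\<close>
  define t where "t = r div s mod M"
  have "r = (r div s div M * M + t) * s + r mod s"
    by (simp only: t_def div_mult_mod_eq)
  then have "r mod (M * s) = (r mod s + t * s + (r div s div M) * (M * s)) mod (M * s)"
    by (metis add.assoc add.commute distrib_right mult.assoc)
  also have "\<dots> = (r mod s + t * s) mod (M * s)" by simp
  also have "\<dots> = r mod s + t * s"
  proof (rule mod_pos_pos_trivial)
    have "t * s \<le> (M - 1) * s" using s by (intro mult_right_mono) (auto simp: t_def zero_less_mult_iff)
    then show "r mod s + t * s < M * s"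
      using pos_mod_bound[OF s(1), of r] by (simp add: algebra_simps)
    show "0 \<le> r mod s + t * s"
      using s by (intro add_nonneg_nonneg mult_nonneg_nonneg) (auto simp: t_def zero_less_mult_iff)
  qed
  finally have r: "r mod (M * s) = r mod s + t * s" .
  have "coprime (r mod s) s" using assms(3) s by simp
  moreover have "r mod s \<in> set [0..s - 1]" "t \<in> set [0..M - 1]"
    using s by (auto simp: t_def zero_less_mult_iff)
  ultimately have "list_ex (row_covers s (r mod (M * s))) R"
    using assms(1) unfolding certified_def list_all_iff r by blast
  then obtain rw where rw: "rw \<in> set R" "row_covers s (r mod (M * s)) rw"
    by (auto simp: list_ex_iff)
  have v: "row_valid s M rw" using assms(1) rw by (auto simp: certified_def list_all_iff)
  show ?thesis
    by (rule two_step_if_row_covers[OF v row_covers_mod[OF v rw(2)] s(1) assms(2)]) (use assms(4) rw(1) in auto)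
qed

text \<open>Non-exceptional \<open>r\<close> have a two-step word. For the others,
  \<open>4 * \<bar>r\<bar> > s\<close> guarantees an entry of \<open>ws\<close> for the absolute
  value, and dividing by \<open>sgn r\<close> restores the sign.\<close>

lemma certified_relation_number:
  assumes c: "certified s M R ws" and r: "coprime r s" "4 * \<bar>r\<bar> > s"
  shows "relation_number (of_int s / of_int r)"
proof (cases "\<bar>r\<bar> \<in> set (concat (map (row_exceptions s) R))")
  case True
  have "\<forall>n \<in> set (concat (map (row_exceptions s) R)).
      4 * n \<le> s \<or> \<not> coprime n s \<or> list_ex (\<lambda>(n', w). n' = n) ws"
    using c unfolding certified_def list_all_iff by blast
  from bspec[OF this True] have "list_ex (\<lambda>(n', w). n' = \<bar>r\<bar>) ws"
    using r by simp
  then obtain w where "(\<bar>r\<bar>, w) \<in> set ws"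
    unfolding list_ex_iff by auto
  then have "closes s \<bar>r\<bar> w 1 0" "0 \<notin> set w"
    using c unfolding certified_def list_all_iff by auto
  moreover have "r \<noteq> 0" using c r by (auto simp: certified_def)
  ultimately obtain l where l: "step_relation_number l (of_int s / of_int \<bar>r\<bar>)"
    using odd_length_if_closes[of s "\<bar>r\<bar>" w] by (metis abs_eq_0 oddE Suc_eq_plus1 order_refl step_relation_number_if_closes)
  have sgn: "sgn r \<noteq> 0" "of_int (sgn r) * of_int \<bar>r\<bar> = (of_int r :: complex)"
    using \<open>r \<noteq> 0\<close> by (simp_all add: sgn_eq_0_iff mult_sgn_abs flip: of_int_mult)
  then have "(of_int s / of_int r :: complex) = of_int s / of_int \<bar>r\<bar> / of_int (sgn r)"
    by (metis divide_divide_eq_left mult.commute)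
  then show ?thesis
    using step_relation_number_divide[OF l sgn(1)] relation_number_if_step_relation_number by metis
next
  case False
  moreover have "r \<noteq> 0" using c r by (auto simp: certified_def)
  ultimately show ?thesis
    using certified_two_step[OF c _ r(1)] relation_number_if_step_relation_number by blast
qed

section \<open>Certificates for the individual numerators\<close>

lemma certified_1:
  "certified 1 1
     [(1, 1, 1, 1)]
     [(1, [1, -2, 1])]"
  by code_simp

lemma certified_2:
  "certified 2 1
     [(1, 1, 1, 1)]
     [(1, [1, -1, 1])]"
  by code_simp

lemma certified_3:
  "certified 3 1
     [(1, 2, 1, 1)]
     [(1, [-1, 1, -1, 1, -1])]"
  by code_simp

lemma certified_4:
  "certified 4 1
     [(1, 3, 1, 1)]
     []"
  by code_simp

lemma certified_5:
  "certified 5 1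
     [(1, 4, 1, 1), (1, 2, 1, -1)]
     [(3, [-3, -1, -1, 1, -1])]"
  by code_simp

lemma certified_6:
  "certified 6 1
     [(1, 5, 1, 1)]
     []"
  by code_simp

lemma certified_7:
  "certified 7 1
     [(1, 6, 1, 1), (1, 2, 1, -1), (1, 3, 1, 1)]
     [(2, [-2, 1, -1, 1, -1, 1, -1, 1, -2]), (4, [-4, -1, 1, -1, -4])]"
  by code_simp

lemma certified_8:
  "certified 8 1
     [(1, 7, 1, 1), (1, 3, 1, -1)]
     [(3, [-1, 1, -1, 1, -6])]"
  by code_simp

lemma certified_9:
  "certified 9 1
     [(1, 4, 1, 1), (1, 8, 1, 1), (1, 2, 1, -1)]
     [(5, [-5, -1, 1, -1, -5])]"
  by code_simp

lemma certified_10: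
  "certified 10 1
     [(1, 9, 1, 1), (1, 3, 1, 1)]
     [(3, [3, -1, 1, -1, 1, -1, 1, -3, 1, -1, 3])]"
  by code_simp

lemma certified_11:
  "certified 11 1
     [(1, 5, 1, 1), (1, 10, 1, 1), (1, 2, 1, -1), (1, 3, 1, -1), (1, 4, 1, -1)]
     [(3, [-3, 2, -1, 1, -1, 1, -1, 1, -1, 1, -1, 2, -3]), (4, [-2, 2, -1, 1, -1, 1, 4]), (6,
      [-6, -1, 1, -1, -6])]"
  by code_simp

lemma certified_12:
  "certified 12 2
     [(1, 11, 1, 1), (1, 5, 1, -2), (1, 7, 2, -2)]
     [(5, [-1, 5, -1, -1, 1, -1, 1]), (7, [-1, 1, -2, 1, -21])]"
  by code_simp

lemma certified_13:
  "certified 13 2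
     [(1, 4, 1, 1), (1, 6, 1, 1), (1, 12, 1, 1), (1, 2, 1, -1), (1, 3, 1, 1), (2, 3, 1, 1), (1,
      5, 1, 2)]
     [(4, [-4, 1, -1, 2, -1, 1, -1, 1, -1, 2, -1, 1, -4]), (5, [-1, 1, -1, 1, 15]), (7, [-7, -1,
      1, -1, -7]), (8, [-8, 1, -1, 2, -4])]"
  by code_simp

lemma certified_14:
  "certified 14 1
     [(1, 5, 1, -1), (1, 13, 1, 1), (1, 3, 1, -1)]
     [(5, [-10, 2, -2, 1, -1, 1, -1])]"
  by code_simp

lemma certified_15:
  "certified 15 1
     [(1, 7, 1, 1), (1, 14, 1, 1), (1, 2, 1, -1), (1, 4, 1, -1)]
     [(4, [-2, 2, -3, 1, -1, 1, -1, 1, -1, 1, -1, 1, -1, 1, -3, 2, -2]), (8, [-2, 4, 1, -1, 1])]"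
  by code_simp

lemma certified_16:
  "certified 16 2
     [(1, 5, 1, 1), (1, 15, 1, 1), (1, 3, 1, 1), (1, 7, 2, 2), (1, 9, 2, 2)]
     [(5, [-5, 1, 3, 1, -1, 1, -1, 1, -1, -6, 5]), (7, [-1, 1, -1, 2, -14]), (9, [-1, 1, -1, -2,
      18])]"
  by code_simp

lemma certified_17:
  "certified 17 4
     [(1, 4, 1, 1), (1, 6, 1, -1), (1, 8, 1, 1), (1, 16, 1, 1), (1, 2, 1, -1), (1, 3, 1, -1),
      (2, 3, 1, -1), (1, 5, 1, -2), (1, 7, 1, -2), (4, 3, 1, -1), (2, 7, 1, -2)]
     [(5, [-10, -1, 1, -1, 1, -1, 1, -1, -10]), (6, [-6, -1, 1, -1, 1, -2, 1, -1, 3]), (7, [-14,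
      -1, -1, 1, -1, 1, -35]), (9, [-9, -1, 1, -1, -9]), (10, [-2, 5, -2, 1, -1, 4, 5]), (12,
      [-12, -1, 1, -2, -6]), (24, [-6, -4, 3, -1, 3])]"
  by code_simp

lemma certified_18:
  "certified 18 6
     [(1, 17, 1, 1), (1, 5, 1, 2), (1, 7, 1, 2), (1, 11, 1, -3), (1, 23, 3, 3), (1, 5, 1, -3),
      (1, 7, 3, 3), (1, 13, 3, -6), (1, 25, 3, -6)]
     [(5, [-5, 1, -5, -1, 1, 2, -2, 1, -1, -1, 2, -1, 1, -1, 1, -1, 1, -1, 1, -2, 3, -1, -15]),
      (7, [-1, 1, -1, 1, 6, -1, 14]), (11, [-1, 1, -1, -1, -9, 3, 11]), (13, [-3, 1, -1, 13, 3,
      -1, 1]), (23, [-2, 2, -1, 23, 4, 1, -1]), (25, [-5, 1, -2, 18, 25])]"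
  by code_simp

lemma certified_19:
  "certified 19 2
     [(1, 5, 1, -1), (1, 6, 1, 1), (1, 9, 1, 1), (1, 18, 1, 1), (1, 2, 1, -1), (1, 3, 1, 1), (1,
      4, 1, -1), (2, 3, 1, 1), (2, 5, 1, -1), (1, 7, 2, -2), (1, 11, 2, -2)]
     [(5, [-5, -1, -1, -14, -1, 1, -1, 1, -1, 1, -1, 1, -1, 1, -1, 1, -1, -14, -1, -1, -5]), (6,
      [-6, 1, -1, 1, -1, 1, -3, 1, -1, 1, -1, 1, -6]), (7, [-1, 1, -1, 1, -3, -2, -14]), (8,
      [-2, 4, -1, 1, -1, 2, 4]), (10, [-2, 5, 1, -1, 1]), (11, [-1, 1, -1, -1, -1, -9, 22]),
      (12, [-12, 1, -1, 2, -6])]"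
  by code_simp

lemma certified_20:
  "certified 20 4
     [(1, 7, 1, -1), (1, 19, 1, 1), (1, 3, 1, -1), (1, 9, 2, -2), (1, 11, 4, 4), (1, 29, 4, 4)]
     [(7, [-21, 2, -1, 2, -1, 1, -1, 1, -9, -1, -7]), (9, [-1, 1, -1, 3, -1, 3, 3]), (11, [-1,
      1, -1, -3, 1, 11, 1]), (29, [-1, 3, -1, 29, 3, 1, -1])]"
  by code_simp

lemma certified_21:
  "certified 21 6
     [(1, 4, 1, 1), (1, 5, 1, 1), (1, 10, 1, 1), (1, 20, 1, 1), (1, 2, 1, -1), (2, 5, 1, 1), (1,
      8, 1, -3), (1, 13, 3, 6), (1, 29, 3, 6)]
     [(8, [-1, 1, -1, 1, -40]), (11, [-11, -1, 1, -1, -11]), (13, [-2, 1, -1, 6, -39]), (29,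
      [-2, 2, -1, -29, 4, 1, -1])]"
  by code_simp

lemma certified_22:
  "certified 22 12
     [(1, 7, 1, 1), (1, 21, 1, 1), (1, 3, 1, 1), (1, 9, 1, -2), (1, 5, 1, -2), (1, 13, 4, 4),
      (1, 27, 4, 4), (1, 5, 1, 3), (3, 5, 1, -2), (3, 7, 1, 1), (1, 13, 1, 3), (1, 17, 2, 12),
      (1, 31, 2, 12)]
     [(7, [-1, 1, -1, 1, -1, 2, -1, 1, -3, -43, 7]), (9, [-9, -2, 2, 1, -1, 1, -1, -7, 9]), (13,
      [-13, 3, 5, -1, 1, -2, 2, 1, -39]), (17, [-1, 1, -17, -4, 1, -1, 17]), (27, [-27, -2, 1,
      -3, -18]), (31, [-1, 1, -31, 3, 1, -1, 31])]"
  by code_simp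

lemma certified_23:
  "certified 23 6
     [(1, 6, 1, -1), (1, 8, 1, -1), (1, 11, 1, 1), (1, 22, 1, 1), (1, 2, 1, -1), (1, 3, 1, -1),
      (1, 4, 1, -1), (1, 9, 1, 2), (2, 3, 1, -1), (1, 5, 1, 2), (1, 7, 2, 2), (1, 13, 2, 2), (3,
      8, 1, -1), (1, 14, 1, -3), (1, 16, 3, -3), (3, 2, 1, -1), (3, 4, 1, -1), (1, 5, 1, -3),
      (2, 5, 1, -3), (1, 7, 1, -3), (2, 13, 3, -3)]
     [(6, [-3, 1, 4, 5, 1, -1, -1, 1, -2, -2, 1, -1, 1, -2, 1, -1, 1, -1, 1, -6, 1, -1, 1, -1,
      1, -1, 1, -1, 1, -1, 1, -1, 1, -1, 3, 1, -2, -1, 1, -1, 4, -1, 1, -2, 1, 8, -1, 1, -1, 1,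
      6]), (7, [-7, 4, 1, 2, -2, 1, -1, 2, -3, 3, 1, -2, 1, 1, -1, 1, -1, 1, -1, 1, 1, -2, 1, 3,
      -3, 2, -1, 1, -2, 2, 1, 4, -7]), (8, [-8, -1, -1, 2, -1, 1, -1, 1, -4, 1, -8]), (9, [-3,
      -3, -1, 1, -1, 1, -18]), (10, [-2, 1, -1, 1, -20]), (12, [-12, -1, 1, -1, -12]), (13,
      [-13, 4, -2, 1, -1, 3, 39]), (14, [-2, 1, -1, 5, -4, -1, 7]), (16, [-16, -1, 1, -2, -8]),
      (18, [-18, -1, 1, -3, -6]), (28, [-14, 1, -2, 2, -7]), (32, [-16, -2, 1, -4, -8]), (36,
      [-6, 3, 2, -1, 4])]"
  by code_simp

lemma certified_25:
  "certified 25 6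
     [(1, 4, 1, 1), (1, 6, 1, 1), (1, 8, 1, 1), (1, 12, 1, 1), (1, 24, 1, 1), (1, 2, 1, -1), (1,
      3, 1, 1), (2, 3, 1, 1), (1, 7, 1, 2), (1, 9, 2, 2), (1, 11, 2, 2), (1, 32, 3, 3), (3, 2,
      1, -1), (3, 4, 1, 1), (1, 7, 3, 3), (2, 7, 3, 3), (1, 16, 3, 3)]
     [(7, [-3, -14, -1, 1, -1, -1, 1, -1, 1, -1, 1, -1, 1, -1, -4, 6, -1, 2, -1, 1, -1, 1, 1,
      -2, -1, -1, 5, 1, 8, -1, 1, 1, -1, 2, -1, -1, 1, -11, 1, -1, 5, 1, -1, 3, 1, -15, 14]),
      (8, [-8, 1, -3, 3, -1, 1, -1, 1, -1, 3, -3, 1, -8]), (9, [-18, 2, -1, 1, -1, 1, 45]), (11,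
      [-1, 1, -1, 2, 8, 2, -2, 3, -1, -2, 22]), (13, [-13, -1, 1, -1, -13]), (14, [-2, -7, -1,
      -2, 1, -1, 2]), (16, [-16, 1, -1, 2, -8]), (18, [-18, 1, -1, 3, -6]), (32, [-16, 2, -1, 4,
      -8]), (39, [-13, -3, 1, -3, -13]), (64, [-16, 4, -1, 8, -8])]"
  by code_simp

lemma certified_26:
  "certified 26 60
     [(1, 5, 1, 1), (1, 9, 1, -1), (1, 25, 1, 1), (1, 3, 1, -1), (1, 7, 2, -2), (1, 15, 2, -2),
      (1, 11, 2, -4), (1, 19, 2, -4), (3, 5, 1, 1), (1, 7, 1, 3), (1, 11, 1, 3), (3, 19, 2, -4),
      (5, 9, 1, -1), (1, 41, 1, 30), (1, 59, 5, 5), (1, 63, 4, 20), (1, 93, 5, -5), (5, 3, 1,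
      -1), (1, 7, 5, -5), (1, 11, 5, 5), (1, 19, 1, 30), (1, 33, 4, 20)]
     [(7, [-1, -1, 1, -1, 1, -1, 1, -1, 1, -1, 1, -1, -10, -1, 2, -1, 4, 1, -1, -45, 2, -1, 1,
      2, -1, -399, -1]), (9, [-1, 1, -1, 1, -1, -1, -3, 3, 6]), (11, [-33, 1, -2, 1, -1, 1,
      88]), (15, [-3, 1, -1, 2, 30]), (19, [-3, 1, -1, 19, 3, -1, 1]), (33, [-3, 1, -2, -7, 2,
      -22, 3]), (41, [-1, 2, -4, 5, 2, 96, 8, 8, -14, 5, -6, 11, 41]), (45, [-5, -1, 2, -3, 3]),
      (59, [2, -1, -17, 16, -20, -59, -2, 17, -17, -1, 2]), (63, [-9, 2, -14, 1, -3]), (93, [-3,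
      1, 18, 6, -93])]"
  by code_simp

lemma certified_27:
  "certified 27 60
     [(1, 7, 1, -1), (1, 13, 1, 1), (1, 26, 1, 1), (1, 2, 1, -1), (1, 4, 1, -1), (1, 11, 1, -2),
      (1, 5, 1, -2), (2, 7, 1, -1), (1, 8, 1, 3), (2, 5, 1, -2), (4, 7, 1, -1), (1, 10, 1, 3),
      (2, 11, 1, -2), (1, 17, 2, 6), (1, 19, 2, 6), (1, 5, 1, 3), (1, 11, 3, 3), (1, 16, 1, 3),
      (1, 22, 3, 3), (2, 5, 1, 3), (4, 5, 1, 3), (2, 11, 3, 3), (2, 17, 2, 6), (1, 35, 4, 12),
      (1, 37, 4, 12), (5, 4, 1, -1), (1, 8, 1, -5), (5, 13, 1, 1), (1, 17, 1, -5), (1, 46, 5,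
      15), (1, 71, 5, 10), (1, 73, 10, -10), (1, 19, 5, 10), (1, 37, 10, -10), (1, 44, 5, 15)]
     [(7, [-1, -1, 1, -1, 1, -1, 1, -1, 1, -1, 1, -1, 1, -1, 1, -1, 1, 3, 2, -5, -2, 1, 4, 2,
      -1, -31, 1, 1, 1, 4, -2, 2, -1, 1, -1, 3, -3, -1, 1, 2, -1, 1, -5, -1, 1, 3, -1, 1, -2, 1,
      9, -1, 2, 1, -1, -4, 1, -1, 1, 23, 2, 3, 3, -1, 1, -1, 1, -1, 1, -1, 1, -3, 1, -1, 1, -1,
      -4, -1, 1, 6, -37076, 1, -1, 1, -1, 1, -1, 1, -2, -1, 1, -1, 1, 44, -1, 1, -3, 1, -3, 3,
      1, -1, 1, -2, 1, -4, -26, -1, -7]), (8, [-4, -2, -1, 1, -2, 7, 1, -3, 2, -1, 1, -1, 1, -1,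
      1, -2, 28]), (10, [-5, -4, 1, -1, 1, -1, 30]), (11, [-11, -2, -2, 1, -1, 1, -2, -2, -11]),
      (14, [-2, 7, 1, -1, 1]), (16, [1, -1, 2, -1, -7, 4, 4]), (17, [-17, -5, -2, 1, -1, 6,
      -34]), (19, [-19, -7, 2, -1, 1, 6, -38]), (22, [-1, 1, -4, -2, -22]), (32, [-32, 3, -1, 2,
      -48]), (35, [-7, -5, 2, -1, 5]), (37, [-2, 2, -1, -37, 4, 1, -1]), (38, [-2, 1, -5, 6, -4,
      7, 38]), (44, [-11, -8, 9, -1, 2]), (46, [-2, -1, 1, -23, 1]), (64, [-16, 12, -13, -1,
      2]), (71, [-1, 3, -7, -26, -9, 21, 71]), (73, [-1, 3, -9, -23, 2, -100, -73])]"
  by code_simp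

subsection \<open>Numbers with small totient quotient\<close>

text \<open>A finite form of the Euler product. Each number splits uniquely into a power of
  \<open>p\<close> and a cofactor prime to \<open>p\<close>; the powers are bounded by a geometric
  series, the cofactors by induction.\<close>

lemma sum_inverse_smooth_le:
  fixes P A :: "nat set"
  assumes "finite P" "\<And>p. p \<in> P \<Longrightarrow> prime p" "finite A" "\<And>a. a \<in> A \<Longrightarrow> a > 0 \<and> prime_factors a \<subseteq> P"
  shows "(\<Sum>a\<in>A. 1 / real a) \<le> (\<Prod>p\<in>P. 1 / (1 - 1 / real p))"
  using assms
proof (induction P arbitrary: A rule: finite_induct)
  case empty
  have "A \<subseteq> {1}"
  proof
    fix a assume "a \<in> A"
    with empty have "a > 0" "prime_factors a = {}" by auto
    then show "a \<in> {1}" by (simp add: prime_factorization_empty_iff)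
  qed
  then have "(\<Sum>a\<in>A. 1 / real a) \<le> (\<Sum>a\<in>{1::nat}. 1 / real a)" by (intro sum_mono2) auto
  then show ?case by simp
next
  case (insert p P)
  have p: "prime p" using insert.prems by simp
  then have p1: "real p > 1" using prime_gt_1_nat[OF p] by simp
  define k where "k a = multiplicity p a" for a
  define c where "c a = a div p ^ k a" for a
  have a: "a = p ^ k a * c a" for a
    unfolding c_def k_def by (simp add: multiplicity_dvd)
  \<comment> \<open>Any common bound on the exponents \<open>k a\<close> would do; it places the
    pairs (k a, c a) in a finite rectangle.\<close>
  define K where "K = (\<Sum>a\<in>A. k a)"
  have "(\<Sum>a\<in>A. 1 / real a) = (\<Sum>a\<in>A. (1 / real p) ^ k a * (1 / real (c a)))"
    by (intro sum.cong refl) (subst (1) a, simp add: power_divide)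
  also have "\<dots> = (\<Sum>(i, b)\<in>(\<lambda>a. (k a, c a)) ` A. (1 / real p) ^ i * (1 / real b))"
    by (subst sum.reindex) (auto intro!: inj_onI simp: a[symmetric], metis a)
  also have "\<dots> \<le> (\<Sum>(i, b)\<in>{..K} \<times> c ` A. (1 / real p) ^ i * (1 / real b))"
    using insert.prems(2) by (intro sum_mono2) (auto simp: K_def intro: member_le_sum)
  also have "\<dots> = (\<Sum>i\<le>K. (1 / real p) ^ i) * (\<Sum>b\<in>c ` A. 1 / real b)"
    by (simp add: sum_product sum.cartesian_product)
  also have "\<dots> \<le> (1 / (1 - 1 / real p)) * (\<Prod>p\<in>P. 1 / (1 - 1 / real p))"
  proof (intro mult_mono)
    have "(\<Sum>i\<le>K. (1 / real p) ^ i) \<le> (\<Sum>i. (1 / real p) ^ i)"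
      using p1 by (intro sum_le_suminf summable_geometric) auto
    also have "\<dots> = 1 / (1 - 1 / real p)" using p1 by (intro suminf_geometric) simp
    finally show "(\<Sum>i\<le>K. (1 / real p) ^ i) \<le> 1 / (1 - 1 / real p)" .
    show "(\<Sum>b\<in>c ` A. 1 / real b) \<le> (\<Prod>p\<in>P. 1 / (1 - 1 / real p))"
    proof (rule insert.IH)
      fix b assume "b \<in> c ` A"
      then obtain x where x: "x \<in> A" "b = c x" by auto
      have pos: "x > 0" and sub: "prime_factors x \<subseteq> insert p P" using insert.prems x by auto
      have b: "b > 0" "b dvd x" using a[of x] pos x(2) by (cases "c x = 0"; metis dvd_triv_right mult_0_right neq0_conv)+
      have "\<not> p dvd b"
        unfolding x(2) c_def k_def using pos p by (intro multiplicity_decompose) auto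
      then have "prime_factors b \<subseteq> P"
        using b pos sub dvd_prime_factors[of x b] by (auto simp: in_prime_factors_iff)
      then show "b > 0 \<and> prime_factors b \<subseteq> P" using b by simp
    qed (use insert.prems in auto)
  qed (use p1 in \<open>auto intro!: sum_nonneg\<close>)
  also have "\<dots> = (\<Prod>p\<in>insert p P. 1 / (1 - 1 / real p))"
    using insert.hyps by simp
  finally show ?case .
qed

text \<open>The Euler product over primes up to \<open>n\<close> is at least \<open>harm n\<close>,
  which is unbounded. Leaving out the prime divisors of \<open>K\<close> costs only the fixed factor
  \<open>C\<close>, so for large \<open>n\<close> the product of 1 - 1/p over the remaining primes,
  which is totient M / M, drops below \<delta>.\<close>

lemma small_totient_coprime:
  fixes K :: nat
  assumes "K > 0" "\<delta> > 0"
  obtains M where "M > 0" "coprime M K" "real (totient M) \<le> \<delta> * real M"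
proof -
  define C where "C = (\<Prod>p\<in>prime_factors K. 1 / (1 - 1 / real p))"
  have g1: "1 / (1 - 1 / real p) > 0" "1 - 1 / real p > 0" if "prime p" for p
    using prime_gt_1_nat[OF that] by auto
  have C: "C > 0" unfolding C_def by (intro prod_pos g1(1)) auto
  obtain n where n: "harm n \<ge> C / \<delta> + 1"
    using filterlim_at_top[THEN iffD1, OF harm_at_top] by (metis eventually_sequentially order_refl)
  have n0: "n > 0" using n C assms by (intro gr0I) (auto simp: harm_def field_simps)
  define P where "P = {p. prime p \<and> p \<le> n}"
  define Q where "Q = P - prime_factors K"
  define M where "M = \<Prod>Q"
  have fin: "finite P" "finite Q" by (auto simp: P_def Q_def)
  have Qp: "prime p" if "p \<in> Q" for p using that by (simp add: Q_def P_def)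
  have M0: "M > 0" unfolding M_def using Qp by (intro prod_pos) (auto simp: prime_gt_0_nat)
  have "0 \<notin> Q" using Qp not_prime_0 by blast
  then have pf: "prime_factors M = Q"
    unfolding M_def using Qp fin
    by (subst prime_factors_prod) (auto simp: prime_factorization_prime)
  have "coprime M K"
    unfolding M_def
  proof (rule prod_coprime_left)
    fix p assume p: "p \<in> Q"
    then have "\<not> p dvd K" using assms(1) by (auto simp: Q_def P_def in_prime_factors_iff)
    then show "coprime p K" using Qp[OF p] by (simp add: prime_imp_coprime)
  qed
  have "harm n \<le> (\<Prod>p\<in>P. 1 / (1 - 1 / real p))"
  proof -
    have "harm n = (\<Sum>a\<in>{1..n}. 1 / real a)" by (simp add: harm_def inverse_eq_divide)
    also have "\<dots> \<le> (\<Prod>p\<in>P. 1 / (1 - 1 / real p))"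
    proof (rule sum_inverse_smooth_le)
      show "a > 0 \<and> prime_factors a \<subseteq> P" if "a \<in> {1..n}" for a
      proof -
        have "p \<le> n" if "p dvd a" for p
          using dvd_imp_le[OF that] \<open>a \<in> {1..n}\<close> by simp
        then show ?thesis using that by (auto simp: P_def in_prime_factors_iff)
      qed
    qed (use fin in \<open>auto simp: P_def\<close>)
    finally show ?thesis .
  qed
  \<comment> \<open>Prime divisors of \<open>K\<close> beyond \<open>n\<close> may be included,
    since every factor is at least 1.\<close>
  also have "\<dots> \<le> (\<Prod>p\<in>Q \<union> prime_factors K. 1 / (1 - 1 / real p))"
  proof (rule prod_mono2)
    show "1 \<le> 1 / (1 - 1 / real p)" if "p \<in> Q \<union> prime_factors K - P" for p
    proof -
      have "prime p" using that Qp by auto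
      then have "real p > 1" using prime_gt_1_nat[of p] by simp
      then show ?thesis by (simp add: le_divide_eq)
    qed
    show "0 \<le> 1 / (1 - 1 / real p)" if "p \<in> P" for p
      using g1(1)[of p] that unfolding P_def by (simp only: mem_Collect_eq less_imp_le)
  qed (use fin in \<open>auto simp: Q_def\<close>)
  also have "\<dots> = (\<Prod>p\<in>Q. 1 / (1 - 1 / real p)) * C"
    unfolding C_def using fin by (subst prod.union_disjoint) (auto simp: Q_def)
  also have "(\<Prod>p\<in>Q. 1 / (1 - 1 / real p)) = 1 / (\<Prod>p\<in>Q. 1 - 1 / real p)"
    by (simp add: prod_dividef)
  finally have "harm n \<le> C / (\<Prod>p\<in>Q. 1 - 1 / real p)" by simp
  moreover have Q0: "(\<Prod>p\<in>Q. 1 - 1 / real p) > 0"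
    using Qp g1 by (intro prod_pos) auto
  ultimately have "(\<Prod>p\<in>Q. 1 - 1 / real p) * (C / \<delta>) \<le> C"
    using n mult_left_mono[of "C / \<delta>" "harm n" "\<Prod>p\<in>Q. 1 - 1 / real p"] by (simp add: field_simps)
  then have "(\<Prod>p\<in>Q. 1 - 1 / real p) \<le> \<delta>" using C assms by (simp add: field_simps)
  moreover have "real (totient M) = real M * (\<Prod>p\<in>Q. 1 - 1 / real p)"
    using totient_formula2[of M] pf by simp
  ultimately have "real (totient M) \<le> \<delta> * real M"
    by (simp add: mult.commute[of \<delta>] mult_left_mono)
  then show ?thesis using that M0 \<open>coprime M K\<close> by blast
qed

text \<open>Induction on \<open>n\<close>: the next modulus is chosen coprime to \<open>K\<close>
  times the product of the previous ones.\<close>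

lemma pairwise_coprime_small_totient:
  fixes K n :: nat
  assumes "K > 0" "\<delta> > 0"
  obtains M :: "nat \<Rightarrow> nat" where
    "\<And>i. i < n \<Longrightarrow> M i > 0 \<and> coprime (M i) K \<and> real (totient (M i)) \<le> \<delta> * real (M i)"
    "\<And>i j. i < n \<Longrightarrow> j < n \<Longrightarrow> i \<noteq> j \<Longrightarrow> coprime (M i) (M j)"
proof -
  have "\<exists>M :: nat \<Rightarrow> nat. (\<forall>i<n. M i > 0 \<and> coprime (M i) K \<and> real (totient (M i)) \<le> \<delta> * real (M i)) \<and>
    (\<forall>i<n. \<forall>j<n. i \<noteq> j \<longrightarrow> coprime (M i) (M j))"
  proof (induction n)
    case (Suc n)
    then obtain M :: "nat \<Rightarrow> nat" where M: "\<forall>i<n. M i > 0 \<and> coprime (M i) K \<and> real (totient (M i)) \<le> \<delta> * real (M i)"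
      "\<forall>i<n. \<forall>j<n. i \<noteq> j \<longrightarrow> coprime (M i) (M j)" by auto
    have "K * (\<Prod>i<n. M i) > 0" using M(1) assms by (simp add: prod_pos)
    then obtain L where L: "L > 0" "coprime L (K * (\<Prod>i<n. M i))" "real (totient L) \<le> \<delta> * real L"
      using small_totient_coprime assms(2) by blast
    have "coprime L (M i)" if "i < n" for i
    proof (rule coprime_divisors[OF dvd_refl _ L(2)])
      show "M i dvd K * (\<Prod>i<n. M i)" using that by (intro dvd_mult dvd_prodI) auto
    qed
    moreover have "coprime L K" using L(2) by simp
    ultimately show ?case
      using M L by (intro exI[of _ "M(n := L)"]) (auto simp: less_Suc_eq coprime_commute)
  qed auto
  then show ?thesis using that by auto
qed

text \<open>As \<open>u\<close> is invertible modulo \<open>M\<close>, r is recovered from its block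
  \<open>r div M\<close> and the residue of u r - 1, which must be a unit. There are at most N div M
  + 1 blocks.\<close>

lemma card_coprime_le:
  fixes u :: int and M N :: nat
  assumes "M > 0" "coprime u (int M)"
  shows "card {r \<in> {1..int N}. coprime (u * r - 1) (int M)} \<le> (N div M + 1) * totient M"
\<comment> \<open>For M = 1 the only residue is 0, whereas \<open>totatives 1\<close> consists of 1,
  so the map into totatives is available only for M > 1.\<close>
proof (cases "M = 1")
  case True
  have "card {r \<in> {1..int N}. coprime (u * r - 1) (int M)} \<le> card {1..int N}"
    by (intro card_mono) auto
  then show ?thesis using True by simp
next
  case False
  then have M: "M > 1" using assms(1) by simp
  let ?A = "{r \<in> {1..int N}. coprime (u * r - 1) (int M)}"
  let ?f = "\<lambda>r. (nat (r div int M), nat ((u * r - 1) mod int M))"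
  have "card ?A \<le> card ({..N div M} \<times> totatives M)"
  proof (rule card_inj_on_le)
    show "inj_on ?f ?A"
    proof (rule inj_onI)
      fix r r' assume r: "r \<in> ?A" "r' \<in> ?A" "?f r = ?f r'"
      then have "r div int M = r' div int M"
        using M by (auto simp: nat_eq_iff pos_imp_zdiv_nonneg_iff)
      moreover have "(u * r - 1) mod int M = (u * r' - 1) mod int M"
        using r M by (auto simp: nat_eq_iff)
      then have "int M dvd (u * r - 1) - (u * r' - 1)" by (simp only: mod_eq_dvd_iff)
      then have "int M dvd u * (r - r')" by (simp add: algebra_simps)
      then have "int M dvd r - r'"
        using assms(2) by (simp add: coprime_dvd_mult_right_iff coprime_commute)
      then have "r mod int M = r' mod int M" by (simp add: mod_eq_dvd_iff)
      ultimately show "r = r'" by (metis div_mult_mod_eq)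
    qed
    show "?f ` ?A \<subseteq> {..N div M} \<times> totatives M"
    proof
      fix z assume "z \<in> ?f ` ?A"
      then obtain r where r: "r \<in> ?A" "z = ?f r" by auto
      let ?y = "(u * r - 1) mod int M"
      have y: "0 \<le> ?y" "?y < int M" using M by auto
      have cop: "coprime ?y (int M)" using r M by simp
      then have "?y \<noteq> 0" using M by auto
      moreover have "coprime (int (nat ?y)) (int M)" using y cop by simp
      then have "coprime (nat ?y) M" by (simp only: coprime_int_iff)
      ultimately have "nat ?y \<in> totatives M"
        using y by (simp add: totatives_def nat_le_iff)
      moreover have "r div int M \<le> int (N div M)"
        using r zdiv_mono1[of r "int N" "int M"] M by (simp add: zdiv_int)
      then have "nat (r div int M) \<le> N div M" by linarith
      ultimately show "z \<in> {..N div M} \<times> totatives M" using r by simp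
    qed
  qed auto
  then show ?thesis by (simp add: card_cartesian_product totient_def)
qed

subsection \<open>Density and the main theorem\<close>

definition non_two_step :: "int \<Rightarrow> int set" where
  "non_two_step s = {r. r \<noteq> 0 \<and> \<not> step_relation_number 2 (of_int s / of_int r)}"

lemma gcd_reduce_fraction:
  fixes r s :: int
  assumes "r \<noteq> 0"
  shows "(of_int s / of_int r :: complex) = of_int (s div gcd r s) / of_int (r div gcd r s)"
    "coprime (r div gcd r s) (s div gcd r s)" "r div gcd r s \<noteq> 0"
proof -
  let ?g = "gcd r s"
  have g: "?g \<noteq> 0" using assms by simp
  have "(of_int s / of_int r :: complex) = of_int (?g * (s div ?g)) / of_int (?g * (r div ?g))"
    by simp
  then show "(of_int s / of_int r :: complex) = of_int (s div ?g) / of_int (r div ?g)"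
    using g by (simp only: of_int_mult) simp
  show "coprime (r div ?g) (s div ?g)" using assms by (intro div_gcd_coprime) simp
  show "r div ?g \<noteq> 0" using assms by (simp add: dvd_div_eq_0_iff)
qed

text \<open>Passing to lowest terms writes each \<open>r\<close> as g r' with g among the finitely
  many divisors of \<open>s\<close>. The set \<open>D\<close> restricts the gcd: all positive values
  are used in the first case, only values above 1 for s = 24.\<close>

lemma finite_non_two_step:
  fixes s :: int
  assumes s: "s > 0"
    and fin: "\<And>g. g \<in> D \<Longrightarrow> g dvd s \<Longrightarrow> finite {r \<in> non_two_step (s div g). coprime r (s div g)}"
  shows "finite {r \<in> non_two_step s. gcd r s \<in> D}"
proof (rule finite_subset)
  let ?A = "\<Union>g\<in>{g \<in> D. g dvd s}. (\<lambda>r. g * r) ` {r \<in> non_two_step (s div g). coprime r (s div g)}"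
  show "{r \<in> non_two_step s. gcd r s \<in> D} \<subseteq> ?A"
  proof
    fix r assume r: "r \<in> {r \<in> non_two_step s. gcd r s \<in> D}"
    then have r0: "r \<noteq> 0" by (simp add: non_two_step_def)
    note red = gcd_reduce_fraction[OF r0, of s]
    have "r div gcd r s \<in> non_two_step (s div gcd r s)"
      using r red(1,3) by (simp add: non_two_step_def)
    with red(2) have "gcd r s * (r div gcd r s) \<in>
        (\<lambda>x. gcd r s * x) ` {r' \<in> non_two_step (s div gcd r s). coprime r' (s div gcd r s)}"
      by (intro imageI) simp
    then show "r \<in> ?A" using r by auto
  qed
  have "finite {g. g dvd s}" using s by (intro finite_divisors_int) simp
  then show "finite ?A" using fin by (intro finite_UN_I finite_imageI) auto
qed

lemma certified_finite:
  assumes "certified s M R ws"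
  shows "finite {r \<in> non_two_step s. coprime r s}"
proof (rule finite_subset)
  let ?E = "set (concat (map (row_exceptions s) R))"
  show "{r \<in> non_two_step s. coprime r s} \<subseteq> ?E \<union> uminus ` ?E"
  proof
    fix r assume "r \<in> {r \<in> non_two_step s. coprime r s}"
    then have "\<bar>r\<bar> \<in> ?E"
      using certified_two_step[OF assms, of r] unfolding non_two_step_def by blast
    then show "r \<in> ?E \<union> uminus ` ?E" by (cases "r \<ge> 0") (auto simp: image_iff intro!: bexI[of _ "- r"])
  qed
qed simp

section \<open>The numerator 24: divisors and a sieve bound\<close>

text \<open>The unit group modulo 24 has exponent 2, so the residue of \<open>r\<close> is its own
  inverse.\<close>

lemma odd_square_mod_24:
  fixes r :: int
  assumes "coprime r 24"
  shows "24 dvd (r mod 24) * r - 1" "r mod 24 \<in> {1..23}" "coprime (r mod 24) 24"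
proof -
  show c: "coprime (r mod 24) 24" using assms by simp
  have "list_all (\<lambda>u. \<not> coprime u (24::int) \<or> 1 \<le> u \<and> u * u mod 24 = 1) [0..23]"
    by code_simp
  moreover have "r mod 24 \<in> set [0..23]" by simp
  ultimately have *: "1 \<le> r mod 24" "(r mod 24) * (r mod 24) mod 24 = 1"
    using c unfolding list_all_iff by blast+
  then show "r mod 24 \<in> {1..23}" by simp
  have "((r mod 24) * r) mod 24 = 1 mod 24" using *(2) by (simp add: mod_mult_right_eq)
  then show "24 dvd (r mod 24) * r - 1" by (simp only: mod_eq_dvd_iff)
qed

text \<open>The gcds of u r - 1 with the 24 moduli are greater than 1 and pairwise coprime, hence
  distinct, and being coprime to 24 they divide x = (u r - 1) / 24. Since u \<le> 23, two of them
  agree modulo u, and \<mu> = d i, \<nu> = -d j are admissible divisors.\<close>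

lemma two_step_24:
  fixes M :: "nat \<Rightarrow> nat"
  assumes r: "coprime r 24" "r > 1" and u: "u = r mod 24"
    and cop: "\<And>i j. i < 24 \<Longrightarrow> j < 24 \<Longrightarrow> i \<noteq> j \<Longrightarrow> coprime (M i) (M j)"
      "\<And>i. i < 24 \<Longrightarrow> coprime (M i) 24"
    and ncop: "\<And>i. i < 24 \<Longrightarrow> \<not> coprime (u * r - 1) (int (M i))"
  shows "step_relation_number 2 (24 / of_int r)"
proof -
  have u1: "u \<in> {1..23}" "24 dvd u * r - 1" using odd_square_mod_24[OF r(1)] by (simp_all add: u)
  obtain x where x: "u * r - 1 = 24 * x" using u1(2) by (auto elim: dvdE)
  \<comment> \<open>Here \<open>r > 1\<close> matters: for r = 1 one has u = 1 and x = 0.\<close>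
  have "1 * 2 \<le> u * r" using u1(1) r by (intro mult_mono) auto
  then have ur: "u * r > 1" by simp
  then have x0: "x \<noteq> 0" using x by auto
  define d where "d i = gcd (u * r - 1) (int (M i))" for i
  have d: "d i dvd x" "d i > 1" if "i < 24" for i
  proof -
    have "d i \<noteq> 1" using ncop[OF that] by (simp add: d_def coprime_iff_gcd_eq_1)
    moreover have "d i > 0" using ur by (simp add: d_def)
    ultimately show "d i > 1" by linarith
    have "coprime (int (M i)) 24" using cop(2)[OF that] by (metis coprime_int_iff of_nat_numeral)
    then have "coprime (d i) 24" unfolding d_def by (meson coprime_divisors dvd_refl gcd_dvd2)
    moreover have "d i dvd 24 * x" unfolding d_def x[symmetric] by simp
    ultimately show "d i dvd x" by (simp add: coprime_dvd_mult_right_iff)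
  qed
  have dist: "d i \<noteq> d j" if "i < 24" "j < 24" "i \<noteq> j" for i j
  proof
    assume eq: "d i = d j"
    have "d i dvd int (M i)" "d i dvd int (M j)" by (simp add: d_def, simp add: eq, simp add: d_def)
    moreover have "coprime (int (M i)) (int (M j))" using cop(1)[OF that] by simp
    ultimately have "is_unit (d i)" by (meson coprime_common_divisor)
    then show False using d(2)[OF that(1)] by simp
  qed
  have "\<not> inj_on (\<lambda>i. d i mod u) {..<24::nat}"
  proof
    assume inj: "inj_on (\<lambda>i. d i mod u) {..<24::nat}"
    have "card {..<24::nat} \<le> card {0..<u}"
      by (rule card_inj_on_le[OF inj]) (use u1 in auto)
    moreover have "nat u \<le> 23" using u1(1) by (simp add: nat_le_iff)
    ultimately show False by simp
  qed
  then obtain i j where ij: "i < 24" "j < 24" "i \<noteq> j" "d i mod u = d j mod u"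
    by (auto simp: inj_on_def)
  have "step_relation_number 2 (of_int 24 / of_int r)"
  proof (rule two_step_if_dvd)
    show "24 * x = u * r - 1" by (simp add: x)
    show "d i dvd x" "- d j dvd x" using d ij by simp_all
    show "u dvd d i + - d j" using ij(4) by (simp add: mod_eq_dvd_iff)
    show "d i + - d j \<noteq> 0" using dist ij by simp
  qed (use x0 r in auto)
  then show ?thesis by simp
qed

text \<open>If r > 1 is coprime to 24 and fails to be two-step, then u r - 1 is coprime to some
  \<open>M i\<close> for u = r mod 24. Each pair (u, i) accounts for few such r because the totient
  quotient of \<open>M i\<close> is small.\<close>

lemma non_two_step_24_card:
  assumes fin: "finite {r \<in> non_two_step 24. \<not> coprime r 24}" and \<epsilon>: "\<epsilon> > 0"
  obtains C where "\<And>N. real (card (non_two_step 24 \<inter> {1..int N})) \<le> C + \<epsilon> * real N"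
proof -
  define U :: "int set" where "U = {u \<in> {1..23}. coprime u 24}"
  \<comment> \<open>At most 24 residues u and 24 moduli contribute, each a proportion
    \<delta>.\<close>
  define \<delta> where "\<delta> = \<epsilon> / (24 * 24)"
  have \<delta>: "\<delta> > 0" using \<epsilon> by (simp add: \<delta>_def)
  \<comment> \<open>Being coprime to \<open>fact 24\<close> makes a modulus coprime to 24 and to
    every residue u \<le> 23 at once.\<close>
  have "fact 24 > (0 :: nat)" by simp
  then obtain M :: "nat \<Rightarrow> nat" where
    M: "\<And>i. i < 24 \<Longrightarrow> M i > 0 \<and> coprime (M i) (fact 24) \<and> real (totient (M i)) \<le> \<delta> * real (M i)"
      "\<And>i j. i < 24 \<Longrightarrow> j < 24 \<Longrightarrow> i \<noteq> j \<Longrightarrow> coprime (M i) (M j)"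
    using pairwise_coprime_small_totient[OF _ \<delta>, of "fact 24" 24] by blast
  have copM: "coprime (M i) k" if "i < 24" "1 \<le> k" "k \<le> 24" for i k
    using M(1)[OF that(1)] dvd_fact[OF that(2,3)] by (meson coprime_divisors dvd_refl)
  \<comment> \<open>The value 1 is added because \<open>two_step_24\<close> requires
    \<open>r > 1\<close>.\<close>
  define F where "F = insert 1 {r \<in> non_two_step 24. \<not> coprime r 24}"
  have F: "finite F" using fin by (simp add: F_def)
  define S where "S N u i = {r \<in> {1..int N}. coprime (u * r - 1) (int (M i))}" for N u i
  define C where "C = real (card F) + (\<Sum>u\<in>U. \<Sum>i<24. real (totient (M i)))"
  have "real (card (non_two_step 24 \<inter> {1..int N})) \<le> C + \<epsilon> * real N" for N
  proof -
    have "U \<subseteq> {1..23}" by (auto simp: U_def)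
    then have U: "finite U" "card U \<le> 24"
      using card_mono[of "{1..23}" U] by (auto intro: finite_subset)
    have sub: "non_two_step 24 \<inter> {1..int N} \<subseteq> F \<union> (\<Union>u\<in>U. \<Union>i<24. S N u i)"
    proof
      fix r assume r: "r \<in> non_two_step 24 \<inter> {1..int N}"
      show "r \<in> F \<union> (\<Union>u\<in>U. \<Union>i<24. S N u i)"
      proof (cases "coprime r 24 \<and> r > 1")
        case True
        have "\<exists>i<24. coprime (r mod 24 * r - 1) (int (M i))"
          using two_step_24[of r "r mod 24" M] True M copM r by (auto simp: non_two_step_def)
        moreover have "r mod 24 \<in> U" using odd_square_mod_24[of r] True by (simp add: U_def)
        ultimately show ?thesis using r by (auto simp: S_def)
      next
        case False
        then show ?thesis using r by (auto simp: F_def)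
      qed
    qed
    have S: "real (card (S N u i)) \<le> real (totient (M i)) + \<delta> * real N" if "u \<in> U" "i < 24" for u i
    proof -
      have u: "1 \<le> u" "u \<le> 23" using that(1) by (auto simp: U_def)
      then have "coprime (nat u) (M i)"
        using copM[OF that(2), of "nat u"] by (subst coprime_commute) (simp add: nat_le_iff)
      then have "coprime (int (nat u)) (int (M i))" by (simp only: coprime_int_iff)
      then have "coprime u (int (M i))" using u by simp
      then have "card (S N u i) \<le> (N div M i + 1) * totient (M i)"
        unfolding S_def using M(1)[OF that(2)] by (intro card_coprime_le) auto
      then have "real (card (S N u i)) \<le> real (N div M i) * real (totient (M i)) + real (totient (M i))"
        by (simp add: algebra_simps flip: of_nat_mult of_nat_add)
      also have "real (N div M i) * real (totient (M i)) \<le> (real N / real (M i)) * (\<delta> * real (M i))"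
        using M(1)[OF that(2)] \<delta> by (intro mult_mono of_nat_div_le_of_nat) auto
      also have "\<dots> = \<delta> * real N" using M(1)[OF that(2)] by simp
      finally show ?thesis by simp
    qed
    have finS: "finite (S N u i)" for u i
      by (rule finite_subset[of _ "{1..int N}"]) (auto simp: S_def)
    have "card (non_two_step 24 \<inter> {1..int N}) \<le> card (F \<union> (\<Union>u\<in>U. \<Union>i<24. S N u i))"
      using F U finS by (intro card_mono[OF _ sub]) auto
    also have "\<dots> \<le> card F + (\<Sum>u\<in>U. \<Sum>i<24. card (S N u i))"
      by (intro order_trans[OF card_Un_le] add_left_mono order_trans[OF card_UN_le[OF U(1)]] sum_mono card_UN_le) auto
    finally have "real (card (non_two_step 24 \<inter> {1..int N}))
        \<le> real (card F) + (\<Sum>u\<in>U. \<Sum>i<24. real (card (S N u i)))"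
      by (simp flip: of_nat_sum of_nat_add)
    also have "(\<Sum>u\<in>U. \<Sum>i<24. real (card (S N u i))) \<le> (\<Sum>u\<in>U. \<Sum>i<24. real (totient (M i)) + \<delta> * real N)"
      using S by (intro sum_mono) auto
    also have "\<dots> = (\<Sum>u\<in>U. \<Sum>i<24. real (totient (M i))) + real (card U) * 24 * \<delta> * real N"
      by (simp add: sum.distrib algebra_simps)
    also have "real (card U) * 24 * \<delta> * real N \<le> 24 * 24 * \<delta> * real N"
      using U(2) \<delta> by (intro mult_right_mono) auto
    finally show ?thesis by (simp add: C_def \<delta>_def algebra_simps)
  qed
  then show ?thesis using that by blast
qed

text \<open>The constant \<open>C\<close> may depend on \<epsilon>: after division by N it
  disappears in the limit, so \<open>B\<close> has density zero.\<close>

lemma has_natural_density_one: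
  assumes "\<And>\<epsilon>. \<epsilon> > 0 \<Longrightarrow> \<exists>C. \<forall>N. real (card (B \<inter> {1..int N})) \<le> C + \<epsilon> * real N"
  shows "has_natural_density ({r. r > 0} - B) 1"
  unfolding has_natural_density_def
proof (rule LIMSEQ_I)
  fix \<epsilon> :: real assume \<epsilon>: "\<epsilon> > 0"
  obtain C where C: "\<And>N. real (card (B \<inter> {1..int N})) \<le> C + \<epsilon> / 2 * real N"
    using assms[of "\<epsilon> / 2"] \<epsilon> by auto
  obtain K where K: "real K > 2 * C / \<epsilon>" using reals_Archimedean2 by blast
  show "\<exists>no. \<forall>N\<ge>no. norm (real (card (({r. r > 0} - B) \<inter> {1..int N})) / real N - 1) < \<epsilon>"
  proof (intro exI allI impI)
    fix N assume N: "N \<ge> max K 1"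
    let ?b = "real (card (B \<inter> {1..int N}))"
    have "({r. r > 0} - B) \<inter> {1..int N} = {1..int N} - B \<inter> {1..int N}" by auto
    then have "card (({r. r > 0} - B) \<inter> {1..int N}) = N - card (B \<inter> {1..int N})"
      by (simp add: card_Diff_subset)
    moreover have "card (B \<inter> {1..int N}) \<le> N"
      using card_mono[of "{1..int N}" "B \<inter> {1..int N}"] by auto
    ultimately have "real (card (({r. r > 0} - B) \<inter> {1..int N})) / real N - 1 = - (?b / real N)"
      using N by (simp add: of_nat_diff field_simps)
    moreover have "C < \<epsilon> / 2 * real N"
    proof -
      have "2 * C / \<epsilon> < real N" using K N by simp
      then show ?thesis using \<epsilon> by (simp add: field_simps)
    qed
    then have "?b < \<epsilon> * real N" using C[of N] by linarith
    then have "?b / real N < \<epsilon>" using N by (simp add: field_simps)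
    ultimately show "norm (real (card (({r. r > 0} - B) \<inter> {1..int N})) / real N - 1) < \<epsilon>"
      by simp
  qed
qed

section \<open>Reduction to lowest terms and conclusion\<close>

lemma ex_certified:
  assumes "0 < s" "s \<le> 27" "s \<noteq> (24::int)"
  shows "\<exists>M R ws. certified s M R ws"
proof -
  have "s \<in> set [1..27]" using assms by simp
  also have "[1..27::int] = [1, 2, 3, 4, 5, 6, 7, 8, 9, 10, 11, 12, 13, 14, 15, 16, 17, 18, 19, 20, 21, 22, 23, 24, 25, 26, 27]"
    by code_simp
  finally show ?thesis
    using assms(3) certified_1 certified_2 certified_3 certified_4 certified_5 certified_6 certified_7
      certified_8 certified_9 certified_10 certified_11 certified_12 certified_13 certified_14 certified_15
      certified_16 certified_17 certified_18 certified_19 certified_20 certified_21 certified_22 certified_23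
      certified_25 certified_26 certified_27
    unfolding set_simps insert_iff empty_iff by metis
qed

text \<open>The only positive multiple of 24 up to 27 is 24 itself, so cancelling a common factor
  never produces the numerator 24 unless it was there and nothing was cancelled.\<close>

lemma div_le_27:
  fixes s g :: int
  assumes "0 < s" "s \<le> 27" "g dvd s" "g > 0" "s \<noteq> 24 \<or> g \<noteq> 1"
  shows "0 < s div g" "s div g \<le> 27" "s div g \<noteq> 24"
proof -
  obtain t where t: "s = g * t" using assms(3) by (auto elim: dvdE)
  then have st: "s div g = t" using assms(4) by simp
  have t0: "t > 0" using assms(1,4) t by (simp add: zero_less_mult_iff)
  have "1 * t \<le> g * t" using assms(4) t0 by (intro mult_right_mono) auto
  then have le: "t \<le> s" using t by simp
  show "0 < s div g" "s div g \<le> 27" using st t0 le assms(2) by auto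
  show "s div g \<noteq> 24"
  proof
    assume "s div g = 24"
    then have "g * 24 \<le> 27" using st t assms(2) by simp
    then have "g = 1" using assms(4) by simp
    then show False using \<open>s div g = 24\<close> assms(5) by simp
  qed
qed

theorem theorem1p4:
  fixes s :: nat
  assumes "s > 0"
  shows "(s \<le> 27 \<and> s \<noteq> 24 \<longrightarrow>
            finite {r :: int. r \<noteq> 0 \<and> \<not> step_relation_number 2 (of_nat s / of_int r)} \<and>
            (\<forall>r :: int. r \<noteq> 0 \<longrightarrow> real s / real_of_int r \<in> {-4<..<4} \<longrightarrow>
               relation_number (of_nat s / of_int r))) \<and>
         (s = 24 \<longrightarrow>
            (\<exists>X :: int set. X \<subseteq> {r. r > 0} \<and> has_natural_density X 1 \<and>
               (\<forall>r \<in> X. step_relation_number 2 (of_nat s / of_int r))))"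
proof (intro conjI impI allI)
  assume s: "s \<le> 27 \<and> s \<noteq> 24"
  have div: "0 < int s div g" "int s div g \<le> 27" "int s div g \<noteq> 24" if "g dvd int s" "g > 0" for g
    using div_le_27[of "int s" g] s that assms by auto
  have "finite {r \<in> non_two_step (int s). gcd r (int s) \<in> {0<..}}"
  proof (rule finite_non_two_step)
    show "finite {r \<in> non_two_step (int s div g). coprime r (int s div g)}"
      if "g \<in> {0<..}" "g dvd int s" for g
      using ex_certified[OF div] certified_finite that by (metis greaterThan_iff)
  qed (use assms in simp)
  moreover have "{r \<in> non_two_step (int s). gcd r (int s) \<in> {0<..}}
      = {r. r \<noteq> 0 \<and> \<not> step_relation_number 2 (of_nat s / of_int r)}"
    using assms by (auto simp: non_two_step_def)
  ultimately show "finite {r :: int. r \<noteq> 0 \<and> \<not> step_relation_number 2 (of_nat s / of_int r)}"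
    by simp
next
  fix r :: int
  assume s: "s \<le> 27 \<and> s \<noteq> 24" and r: "r \<noteq> 0" and q: "real s / real_of_int r \<in> {-4<..<4}"
  define g where "g = gcd r (int s)"
  have g: "g > 0" "g dvd int s" "g dvd r" using r by (simp_all add: g_def)
  note red = gcd_reduce_fraction[OF r, of "int s", folded g_def]
  have "real s < 4 * \<bar>real_of_int r\<bar>"
    using q r by (cases "r > 0") (auto simp: field_simps)
  then have "int s < 4 * \<bar>r\<bar>" by linarith
  \<comment> \<open>The bound |s / r| < 4 is carried over to the reduced fraction, whose numerator
    has a certificate.\<close>
  then have "g * (int s div g) < g * (4 * \<bar>r div g\<bar>)"
    using g by (auto simp: abs_mult elim!: dvdE)
  then have "int s div g < 4 * \<bar>r div g\<bar>" using g(1) by simp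
  moreover obtain M R ws where "certified (int s div g) M R ws"
    using ex_certified[OF div_le_27[of "int s" g]] g s assms by auto
  ultimately have "relation_number (of_int (int s div g) / of_int (r div g))"
    using certified_relation_number red(2) by blast
  then show "relation_number (of_nat s / of_int r)"
    unfolding red(1)[symmetric] by simp
next
  assume s24: "s = 24"
  define X where "X = {r. r > 0} - non_two_step 24"
  \<comment> \<open>For gcd above 1 the reduced numerator is a proper divisor of 24 and is
    certified, so only finitely many exceptions are not coprime to 24.\<close>
  have "finite {r \<in> non_two_step 24. gcd r 24 \<in> {1<..}}"
  proof (rule finite_non_two_step)
    show "finite {r \<in> non_two_step (24 div g). coprime r (24 div g)}" if "g \<in> {1<..}" "g dvd 24" for g
      using ex_certified[OF div_le_27[of 24 g]] certified_finite that by force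
  qed simp
  moreover have "{r \<in> non_two_step 24. gcd r 24 \<in> {1<..}} = {r \<in> non_two_step 24. \<not> coprime r 24}"
  proof -
    have "gcd r 24 > 1 \<longleftrightarrow> gcd r 24 \<noteq> 1" for r :: int
      using gcd_pos_int[of r 24] by linarith
    then show ?thesis by (auto simp: coprime_iff_gcd_eq_1)
  qed
  ultimately have fin: "finite {r \<in> non_two_step 24. \<not> coprime r 24}" by simp
  have "has_natural_density X 1"
    unfolding X_def using non_two_step_24_card[OF fin] by (intro has_natural_density_one) meson
  moreover have "\<forall>r \<in> X. step_relation_number 2 (of_nat s / of_int r)"
    by (auto simp: X_def non_two_step_def s24)
  ultimately show "\<exists>X :: int set. X \<subseteq> {r. r > 0} \<and> has_natural_density X 1 \<and>
      (\<forall>r \<in> X. step_relation_number 2 (of_nat s / of_int r))"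
    by (intro exI[of _ X]) (auto simp: X_def)
qed

end
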